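(* Let $(\Omega,\mathcal{H},\hat{\mathbb{E}})$ be a sublinear expectation space and let $\{X_k\}_{k\ge1}\subset\mathcal{H}^d$ be a $d$-dimensional identical sequence which is $\alpha$-mixing for some $\alpha>0$ and satisfies $\hat{\mathbb{E}}[|X_1|^2]<\infty$. Let $P(x)=a_mx^m+\cdots+a_1x+a_0$ be a real polynomial with $a_m>0$ for some $m\ge2$, let $t_k=\lfloor P(k)\rfloor\vee1$ for $k\in\mathbb{N}$, and let $\Gamma:=\{\mathbb{E}[X_1]:\mathbb{E}\in\Theta\}$. Then there exists $C>0$ such that for every $\phi\in C_{lip}(\mathbb{R}^d)$ with Lipschitz constant $l_\phi>0$ and for all $n\in\mathbb{N}$, $$\Big|\hat{\mathbb{E}}\Big[\phi\Big(\frac1n\sum_{k=1}^nX_{t_k}\Big)\Big]-\max_{x\in\Gamma}\phi(x)\Big|\le C\,l_\phi\,n^{-1/2}.$$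
   Context: $\Omega$ is a nonempty set and $\mathcal{H}$ is a linear space of real-valued functions on $\Omega$ that contains the constants, contains $|X|$ whenever it contains $X$, and contains $\phi(X_1,\dots,X_n)$ for all $X_1,\dots,X_n\in\mathcal{H}$ and $\phi\in C_{lip}(\mathbb{R}^n)$ (Lipschitz functions). A sublinear expectation is a functional $\hat{\mathbb{E}}:\mathcal{H}\to\mathbb{R}$ that is monotone, preserves constants, is sub-additive, and is positively homogeneous; it is a linear expectation if it is moreover linear. $\Theta$ is the set of all linear expectations $\mathbb{E}$ on $\mathcal{H}$ with $\mathbb{E}[X]\le\hat{\mathbb{E}}[X]$ for all $X\in\mathcal{H}$. For $X=(X^1,\dots,X^d)\in\mathcal{H}^d$, $\mathbb{E}[X]:=(\mathbb{E}[X^1],\dots,\mathbb{E}[X^d])$ and $|X|:=\sum_i|X^i|$. Writing $\hat{\mathbb{E}}[|X_1|^2]<\infty$ presupposes $|X_1|^2\in\mathcal{H}$. Identical sequence: $\hat{\mathbb{E}}[\psi(X_k)]=\hat{\mathbb{E}}[\psi(X_l)]$ for all $k,l$ and all $\psi\in C_{lip}(\mathbb{R}^d)$. $\alpha$-mixing (for a given $\alpha>0$): there exists $c_X>0$ such that for all nonempty finite $\Lambda^1,\Lambda^2\subset\mathbb{N}$ with $\max\Lambda^1\le\min\Lambda^2$ and all $\phi\in C_{lip}(\mathbb{R}^{2d})$ with Lipschitz constant $l_\phi>0$, $$\big|\hat{\mathbb{E}}[\phi(\bar X_{\Lambda^1},\bar X_{\Lambda^2})]-\hat{\mathbb{E}}\big[\hat{\mathbb{E}}[\phi(x,\bar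 X_{\Lambda^2})]|_{x=\bar X_{\Lambda^1}}\big]\big|\le c_Xl_\phi e^{-\alpha|\min\Lambda^2-\max\Lambda^1|},$$ where $\bar X_{\Lambda}=\frac1{|\Lambda|}\sum_{u\in\Lambda}X_u$. *)

theory Defs
  imports "HOL-Analysis.Analysis" "HOL-Computational_Algebra.Polynomial"
begin

text \<open>The sample space is a type \<open>'w\<close> (types are nonempty), and an expectation on \<open>H\<close> is a total
  functional on \<open>'w \<Rightarrow> real\<close> of which only the values on \<open>H\<close> are constrained or used.\<close>

text \<open>Functions on n-dimensional Euclidean space with \<open>n\<close> a variable are encoded as functions on
  \<open>nat \<Rightarrow> real\<close>; the Lipschitz bound forces \<open>\<phi>\<close> to depend on the coordinates \<open>i < n\<close> only.\<close>

definition C_lip :: "nat \<Rightarrow> ((nat \<Rightarrow> real) \<Rightarrow> real) set" where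
  "C_lip n = {\<phi>. \<exists>L. \<forall>x y. \<bar>\<phi> x - \<phi> y\<bar> \<le> L * L2_set (\<lambda>i. x i - y i) {..<n}}"

definition rv_space :: "('w \<Rightarrow> real) set \<Rightarrow> bool" where
  "rv_space H \<longleftrightarrow>
     (\<forall>X\<in>H. \<forall>Y\<in>H. (\<lambda>\<omega>. X \<omega> + Y \<omega>) \<in> H) \<and>
     (\<forall>c. \<forall>X\<in>H. (\<lambda>\<omega>. c * X \<omega>) \<in> H) \<and>
     (\<forall>c. (\<lambda>\<omega>. c) \<in> H) \<and>
     (\<forall>X\<in>H. (\<lambda>\<omega>. \<bar>X \<omega>\<bar>) \<in> H) \<and>
     (\<forall>n X. \<forall>\<phi>\<in>C_lip n. (\<forall>i<n. X i \<in> H) \<longrightarrow> (\<lambda>\<omega>. \<phi> (\<lambda>i. X i \<omega>)) \<in> H)"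

definition sublinear_expectation ::
    "('w \<Rightarrow> real) set \<Rightarrow> (('w \<Rightarrow> real) \<Rightarrow> real) \<Rightarrow> bool" where
  "sublinear_expectation H E \<longleftrightarrow>
     (\<forall>X\<in>H. \<forall>Y\<in>H. (\<forall>\<omega>. X \<omega> \<le> Y \<omega>) \<longrightarrow> E X \<le> E Y) \<and>
     (\<forall>c. E (\<lambda>\<omega>. c) = c) \<and>
     (\<forall>X\<in>H. \<forall>Y\<in>H. E (\<lambda>\<omega>. X \<omega> + Y \<omega>) \<le> E X + E Y) \<and>
     (\<forall>c\<ge>0. \<forall>X\<in>H. E (\<lambda>\<omega>. c * X \<omega>) = c * E X)"

definition linear_expectation ::
    "('w \<Rightarrow> real) set \<Rightarrow> (('w \<Rightarrow> real) \<Rightarrow> real) \<Rightarrow> bool" where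
  "linear_expectation H E \<longleftrightarrow>
     sublinear_expectation H E \<and>
     (\<forall>X\<in>H. \<forall>Y\<in>H. E (\<lambda>\<omega>. X \<omega> + Y \<omega>) = E X + E Y) \<and>
     (\<forall>c. \<forall>X\<in>H. E (\<lambda>\<omega>. c * X \<omega>) = c * E X)"

definition dominated_expectations ::
    "('w \<Rightarrow> real) set \<Rightarrow> (('w \<Rightarrow> real) \<Rightarrow> real) \<Rightarrow> (('w \<Rightarrow> real) \<Rightarrow> real) set" where
  "dominated_expectations H Ehat = {E. linear_expectation H E \<and> (\<forall>X\<in>H. E X \<le> Ehat X)}"

definition random_vector :: "('w \<Rightarrow> real) set \<Rightarrow> ('w \<Rightarrow> real ^ 'd) \<Rightarrow> bool" where
  "random_vector H X \<longleftrightarrow> (\<forall>i. (\<lambda>\<omega>. X \<omega> $ i) \<in> H)"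

definition expectation_vec ::
    "(('w \<Rightarrow> real) \<Rightarrow> real) \<Rightarrow> ('w \<Rightarrow> real ^ 'd) \<Rightarrow> real ^ 'd" where
  "expectation_vec E X = (\<chi> i. E (\<lambda>\<omega>. X \<omega> $ i))"

text \<open>The size of a random vector is the sum of the absolute values of its coordinates. The
  distinction from the Euclidean norm matters for whether its square belongs to \<open>H\<close>.\<close>

definition abs_vec :: "real ^ 'd \<Rightarrow> real" where
  "abs_vec x = (\<Sum>i\<in>UNIV. \<bar>x $ i\<bar>)"

text \<open>Sequences are indexed by the positive integers; the value at index \<open>0\<close> is never used.
  Lipschitz constants are any admissible bound for the Euclidean metric; the metric on
  \<open>(real ^ 'd) \<times> (real ^ 'd)\<close> is the Euclidean one of the doubled dimension.\<close>

definition identical_sequence ::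
    "(('w \<Rightarrow> real) \<Rightarrow> real) \<Rightarrow> (nat \<Rightarrow> 'w \<Rightarrow> real ^ 'd) \<Rightarrow> bool" where
  "identical_sequence Ehat X \<longleftrightarrow>
     (\<forall>k\<ge>1. \<forall>l\<ge>1. \<forall>\<psi> :: real ^ 'd \<Rightarrow> real. (\<exists>L. L-lipschitz_on UNIV \<psi>) \<longrightarrow>
        Ehat (\<lambda>\<omega>. \<psi> (X k \<omega>)) = Ehat (\<lambda>\<omega>. \<psi> (X l \<omega>)))"

definition avg :: "(nat \<Rightarrow> 'w \<Rightarrow> real ^ 'd) \<Rightarrow> nat set \<Rightarrow> 'w \<Rightarrow> real ^ 'd" where
  "avg X \<Lambda> \<omega> = (1 / real (card \<Lambda>)) *\<^sub>R (\<Sum>u\<in>\<Lambda>. X u \<omega>)"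

definition alpha_mixing ::
    "(('w \<Rightarrow> real) \<Rightarrow> real) \<Rightarrow> real \<Rightarrow> (nat \<Rightarrow> 'w \<Rightarrow> real ^ 'd) \<Rightarrow> bool" where
  "alpha_mixing Ehat \<alpha> X \<longleftrightarrow>
     (\<exists>c>0. \<forall>\<Lambda>1 \<Lambda>2.
        finite \<Lambda>1 \<and> \<Lambda>1 \<noteq> {} \<and> \<Lambda>1 \<subseteq> {1..} \<and>
        finite \<Lambda>2 \<and> \<Lambda>2 \<noteq> {} \<and> \<Lambda>2 \<subseteq> {1..} \<and> Max \<Lambda>1 \<le> Min \<Lambda>2 \<longrightarrow>
        (\<forall>(\<phi> :: (real ^ 'd) \<times> (real ^ 'd) \<Rightarrow> real) l. l > 0 \<and> l-lipschitz_on UNIV \<phi> \<longrightarrow>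
           \<bar>Ehat (\<lambda>\<omega>. \<phi> (avg X \<Lambda>1 \<omega>, avg X \<Lambda>2 \<omega>))
             - Ehat (\<lambda>\<omega>. Ehat (\<lambda>\<omega>'. \<phi> (avg X \<Lambda>1 \<omega>, avg X \<Lambda>2 \<omega>')))\<bar>
           \<le> c * l * exp (- \<alpha> * \<bar>real (Min \<Lambda>2) - real (Max \<Lambda>1)\<bar>)))"

definition poly_time :: "real poly \<Rightarrow> nat \<Rightarrow> nat" where
  "poly_time P k = nat (max \<lfloor>poly P (real k)\<rfloor> 1)"

definition mean_set ::
    "('w \<Rightarrow> real) set \<Rightarrow> (('w \<Rightarrow> real) \<Rightarrow> real) \<Rightarrow> ('w \<Rightarrow> real ^ 'd) \<Rightarrow> (real ^ 'd) set" where
  "mean_set H Ehat Y = {expectation_vec E Y | E. E \<in> dominated_expectations H Ehat}"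

end

theory Submission
  imports Defs
begin

text \<open>Write \<open>T g s = E (g (s + X 1 / n))\<close>. The gaps of \<open>t\<^sub>k\<close> grow at least linearly, so by mixing,
  peeling off the summands from the last one replaces \<open>E (\<phi> (S\<^sub>n / n))\<close> by \<open>(T ^^ n) \<phi> 0\<close> with an
  error \<open>O(l / n)\<close>; the finitely many initial times cost as much.
  The iterate is compared with \<open>max \<phi>\<close> on \<open>\<Gamma>\<close> using the \<open>1\<close>-Lipschitz function
  \<open>v \<mapsto> sqrt (\<epsilon>\<^sup>2 + |v|\<^sup>2)\<close> with \<open>\<epsilon> = 1 / sqrt n\<close>, which stays in \<open>H\<close> (the squares of the
  coordinates need not). A step \<open>v + (X 1 - k) / n\<close> increases it by a first-order term plus
  \<open>O(1 / (\<epsilon> n\<^sup>2))\<close>. For the upper bound, \<open>k \<in> \<Gamma>\<close> is chosen with \<open>v \<bullet> k = E (v \<bullet> X 1)\<close>; for the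
  lower bound, \<open>k\<close> is the maximiser of \<open>\<phi>\<close> and \<open>E\<close> is replaced by a linear expectation with mean \<open>k\<close>.
  In both cases the first-order term vanishes. That \<open>\<Gamma>\<close> is compact and has support function
  \<open>p \<mapsto> E (p \<bullet> X 1)\<close> is a Hahn-Banach argument: minimal sublinear functionals are linear.\<close>

section \<open>Sublinear functionals on a vector space of functions, and Hahn-Banach\<close>

locale function_space =
  fixes H :: "('w \<Rightarrow> real) set"
  assumes zero_in: "(\<lambda>\<omega>. 0) \<in> H"
    and add_in: "X \<in> H \<Longrightarrow> Y \<in> H \<Longrightarrow> (\<lambda>\<omega>. X \<omega> + Y \<omega>) \<in> H"
    and scale_in: "X \<in> H \<Longrightarrow> (\<lambda>\<omega>. c * X \<omega>) \<in> H"
begin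

lemma minus_in: "X \<in> H \<Longrightarrow> (\<lambda>\<omega>. - X \<omega>) \<in> H"
  using scale_in[of X "-1"] by simp

lemma diff_in: "X \<in> H \<Longrightarrow> Y \<in> H \<Longrightarrow> (\<lambda>\<omega>. X \<omega> - Y \<omega>) \<in> H"
  using add_in[of X "\<lambda>\<omega>. - Y \<omega>"] minus_in by simp

text \<open>Homogeneity is asked for as an inequality with positive factors, the form that passes
  easily to infima; equality follows by applying it to the inverse factor. Monotonicity and the
  values at constants are recovered later from domination by the expectation.\<close>

definition sublinear :: "(('w \<Rightarrow> real) \<Rightarrow> real) \<Rightarrow> bool" where
  "sublinear p \<longleftrightarrow>
     (\<forall>X\<in>H. \<forall>Y\<in>H. p (\<lambda>\<omega>. X \<omega> + Y \<omega>) \<le> p X + p Y) \<and>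
     (\<forall>c>0. \<forall>X\<in>H. p (\<lambda>\<omega>. c * X \<omega>) \<le> c * p X)"

lemma sublinear_add:
  "sublinear p \<Longrightarrow> X \<in> H \<Longrightarrow> Y \<in> H \<Longrightarrow> p (\<lambda>\<omega>. X \<omega> + Y \<omega>) \<le> p X + p Y"
  by (simp add: sublinear_def)

lemma sublinear_scale:
  assumes "sublinear p" "X \<in> H" "c > 0"
  shows "p (\<lambda>\<omega>. c * X \<omega>) = c * p X"
proof (rule antisym)
  show "p (\<lambda>\<omega>. c * X \<omega>) \<le> c * p X"
    using assms by (simp add: sublinear_def)
  have "p (\<lambda>\<omega>. inverse c * (c * X \<omega>)) \<le> inverse c * p (\<lambda>\<omega>. c * X \<omega>)"
    using assms scale_in[of X c] by (simp add: sublinear_def del: mult.assoc)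
  moreover have "(\<lambda>\<omega>. inverse c * (c * X \<omega>)) = X"
    using assms(3) by auto
  ultimately show "c * p X \<le> p (\<lambda>\<omega>. c * X \<omega>)"
    using assms(3) by (simp add: field_simps)
qed

lemma sublinear_zero: "sublinear p \<Longrightarrow> p (\<lambda>\<omega>. 0) = 0"
  using sublinear_scale[of p "\<lambda>\<omega>. 0" 2] zero_in by simp

lemma sublinear_minus:
  assumes "sublinear p" "X \<in> H"
  shows "- p (\<lambda>\<omega>. - X \<omega>) \<le> p X"
  using sublinear_add[OF assms(1,2) minus_in[OF assms(2)]] sublinear_zero[OF assms(1)]
  by simp

lemma sublinear_cong:
  assumes "sublinear p" "\<And>X. X \<in> H \<Longrightarrow> q X = p X"
  shows "sublinear q"
  using assms add_in scale_in by (simp add: sublinear_def)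

text \<open>Infima are not subadditive in general. Here any two indices admit a third one whose
  value at the sum is controlled by both. Chains, tilts, and the shifts by multiples of a random
  vector all have this property.\<close>

lemma sublinear_INF:
  assumes ne: "I \<noteq> {}"
    and bdd: "\<And>Z. Z \<in> H \<Longrightarrow> bdd_below ((\<lambda>i. F i Z) ` I)"
    and add: "\<And>i j Z W. i \<in> I \<Longrightarrow> j \<in> I \<Longrightarrow> Z \<in> H \<Longrightarrow> W \<in> H \<Longrightarrow>
      \<exists>k\<in>I. F k (\<lambda>\<omega>. Z \<omega> + W \<omega>) \<le> F i Z + F j W"
    and scale: "\<And>i c Z. i \<in> I \<Longrightarrow> c > 0 \<Longrightarrow> Z \<in> H \<Longrightarrow> \<exists>k\<in>I. F k (\<lambda>\<omega>. c * Z \<omega>) \<le> c * F i Z"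
  shows "sublinear (\<lambda>Z. INF i\<in>I. F i Z)"
  unfolding sublinear_def
proof (intro conjI ballI allI impI)
  fix Z W assume ZW: "Z \<in> H" "W \<in> H"
  let ?u = "INF i\<in>I. F i (\<lambda>\<omega>. Z \<omega> + W \<omega>)"
  have *: "?u \<le> F i Z + F j W" if ij: "i \<in> I" "j \<in> I" for i j
  proof -
    obtain k where "k \<in> I" "F k (\<lambda>\<omega>. Z \<omega> + W \<omega>) \<le> F i Z + F j W"
      using add[OF ij ZW] by blast
    moreover have "?u \<le> F k (\<lambda>\<omega>. Z \<omega> + W \<omega>)"
      using cINF_lower[OF bdd[OF add_in[OF ZW]] \<open>k \<in> I\<close>] .
    ultimately show ?thesis by linarith
  qed
  have "?u - F j W \<le> (INF i\<in>I. F i Z)" if "j \<in> I" for j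
    using * that by (intro cINF_greatest ne) (force simp: algebra_simps)
  then have "?u - (INF i\<in>I. F i Z) \<le> (INF i\<in>I. F i W)"
    by (intro cINF_greatest ne) (force simp: algebra_simps)
  then show "?u \<le> (INF i\<in>I. F i Z) + (INF i\<in>I. F i W)" by linarith
next
  fix c :: real and Z assume c: "c > 0" and Z: "Z \<in> H"
  let ?u = "INF i\<in>I. F i (\<lambda>\<omega>. c * Z \<omega>)"
  have "?u / c \<le> F i Z" if i: "i \<in> I" for i
  proof -
    obtain k where "k \<in> I" "F k (\<lambda>\<omega>. c * Z \<omega>) \<le> c * F i Z"
      using scale[OF i c Z] by blast
    moreover have "?u \<le> F k (\<lambda>\<omega>. c * Z \<omega>)"
      using cINF_lower[OF bdd[OF scale_in[OF Z]] \<open>k \<in> I\<close>] .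
    ultimately show ?thesis using c by (simp add: field_simps)
  qed
  then have "?u / c \<le> (INF i\<in>I. F i Z)"
    by (intro cINF_greatest ne)
  then show "?u \<le> c * (INF i\<in>I. F i Z)"
    using c by (simp add: field_simps)
qed

text \<open>The tilt forces the value at \<open>Y\<close>: taking \<open>t = 0\<close> gives
  \<open>q \<le> p\<close>, and \<open>t = 1\<close> at \<open>- Y\<close> gives at most
  \<open>- p Y\<close>. Hence a linear functional below \<open>q\<close> takes exactly the value
  \<open>p Y\<close> at \<open>Y\<close>.\<close>

lemma sublinear_tilt:
  fixes Y p
  defines "q \<equiv> \<lambda>X. INF t\<in>{0::real..}. p (\<lambda>\<omega>. X \<omega> + t * Y \<omega>) - t * p Y"
  assumes p: "sublinear p" and Y: "Y \<in> H"
  shows "sublinear q"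
    and "X \<in> H \<Longrightarrow> t \<ge> 0 \<Longrightarrow> q X \<le> p (\<lambda>\<omega>. X \<omega> + t * Y \<omega>) - t * p Y"
proof -
  let ?F = "\<lambda>t X. p (\<lambda>\<omega>. X \<omega> + t * Y \<omega>) - t * p Y"
  \<comment> \<open>A lower bound free of \<open>t\<close> makes the infimum a genuine one; it comes
    from splitting \<open>t * Y\<close> as \<open>(Z + t * Y) + - Z\<close>.\<close>
  have low: "- p (\<lambda>\<omega>. - Z \<omega>) \<le> ?F t Z" if Z: "Z \<in> H" and t: "t \<in> {0..}" for Z t
  proof -
    have "p (\<lambda>\<omega>. t * Y \<omega>) = t * p Y"
      using sublinear_scale[OF p Y, of t] sublinear_zero[OF p] t by (cases "t = 0") auto
    moreover have "p (\<lambda>\<omega>. (Z \<omega> + t * Y \<omega>) + - Z \<omega>) \<le> p (\<lambda>\<omega>. Z \<omega> + t * Y \<omega>) + p (\<lambda>\<omega>. - Z \<omega>)"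
      by (intro sublinear_add p add_in minus_in scale_in Z Y)
    moreover have "(\<lambda>\<omega>. (Z \<omega> + t * Y \<omega>) + - Z \<omega>) = (\<lambda>\<omega>. t * Y \<omega>)"
      by auto
    ultimately show ?thesis by simp
  qed
  then have bdd: "bdd_below ((\<lambda>t. ?F t Z) ` {0..})" if "Z \<in> H" for Z
    using that by (intro bdd_belowI2[where m = "- p (\<lambda>\<omega>. - Z \<omega>)"]) auto
  show "X \<in> H \<Longrightarrow> t \<ge> 0 \<Longrightarrow> q X \<le> ?F t X"
    unfolding q_def by (intro cINF_lower bdd) auto
  show "sublinear q"
    unfolding q_def
  proof (rule sublinear_INF)
    fix i j :: real and Z W assume *: "i \<in> {0..}" "j \<in> {0..}" "Z \<in> H" "W \<in> H"
    have "p (\<lambda>\<omega>. (Z \<omega> + i * Y \<omega>) + (W \<omega> + j * Y \<omega>))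
        \<le> p (\<lambda>\<omega>. Z \<omega> + i * Y \<omega>) + p (\<lambda>\<omega>. W \<omega> + j * Y \<omega>)"
      by (intro sublinear_add p add_in scale_in * Y)
    then have "?F (i + j) (\<lambda>\<omega>. Z \<omega> + W \<omega>) \<le> ?F i Z + ?F j W"
      by (simp add: algebra_simps)
    then show "\<exists>k\<in>{0..}. ?F k (\<lambda>\<omega>. Z \<omega> + W \<omega>) \<le> ?F i Z + ?F j W"
      using * by (intro bexI[of _ "i + j"]) auto
  next
    fix i c :: real and Z assume *: "i \<in> {0..}" "c > 0" "Z \<in> H"
    have "p (\<lambda>\<omega>. c * (Z \<omega> + i * Y \<omega>)) = c * p (\<lambda>\<omega>. Z \<omega> + i * Y \<omega>)"
      by (intro sublinear_scale p add_in scale_in * Y)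
    then have "?F (c * i) (\<lambda>\<omega>. c * Z \<omega>) \<le> c * ?F i Z"
      by (simp add: algebra_simps)
    then show "\<exists>k\<in>{0..}. ?F k (\<lambda>\<omega>. c * Z \<omega>) \<le> c * ?F i Z"
      using * by (intro bexI[of _ "c * i"]) auto
  qed (use bdd in auto)
qed

text \<open>Zorn's lemma is applied to functionals normalised to \<open>0\<close> outside \<open>H\<close>, so that the pointwise
  order on all of \<open>'w \<Rightarrow> real\<close> is the order on \<open>H\<close>.\<close>

lemma minimal_sublinear_exists:
  assumes p: "sublinear p"
  obtains q where "sublinear q" "\<And>X. X \<in> H \<Longrightarrow> q X \<le> p X"
    "\<forall>r. sublinear r \<longrightarrow> (\<forall>X\<in>H. r X \<le> q X) \<longrightarrow> (\<forall>X\<in>H. r X = q X)"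
proof -
  define A where "A = {q. sublinear q \<and> (\<forall>X\<in>H. q X \<le> p X) \<and> (\<forall>X. X \<notin> H \<longrightarrow> q X = 0)}"
  \<comment> \<open>The order is reversed, so that the maximal element given by Zorn's lemma is a
    minimal functional.\<close>
  let ?P = "\<lambda>a b :: ('w \<Rightarrow> real) \<Rightarrow> real. b \<le> a"
  have "\<exists>m\<in>A. \<forall>a\<in>A. ?P m a \<longrightarrow> a = m"
  proof (rule predicate_Zorn)
    show "partial_order_on A (relation_of ?P A)"
      by (rule partial_order_on_relation_ofI) auto
  next
    fix C assume "C \<in> Chains (relation_of ?P A)"
    then have CA: "C \<subseteq> A" and chain: "\<And>a b. a \<in> C \<Longrightarrow> b \<in> C \<Longrightarrow> a \<le> b \<or> b \<le> a"
      by (auto simp: Chains_def relation_of_def)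
    define u where "u Z = (INF q\<in>C. q Z)" for Z
    show "\<exists>u\<in>A. \<forall>a\<in>C. ?P a u"
    proof (cases "C = {}")
      case True
      \<comment> \<open>The empty chain is bounded by \<open>p\<close> itself, normalised outside
        \<open>H\<close>.\<close>
      have "(\<lambda>X. if X \<in> H then p X else 0) \<in> A"
        by (auto simp: A_def intro: sublinear_cong[OF p])
      then show ?thesis using True by auto
    next
      case False
      \<comment> \<open>Each member satisfies \<open>q Z \<ge> - q (- Z) \<ge> - p (- Z)\<close>, a
        bound common to the whole chain.\<close>
      have bdd: "bdd_below ((\<lambda>q. q Z) ` C)" if Z: "Z \<in> H" for Z
      proof (rule bdd_belowI2)
        fix q assume "q \<in> C"
        then have "q \<in> A" using CA by auto
        then show "- p (\<lambda>\<omega>. - Z \<omega>) \<le> q Z"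
          using sublinear_minus[of q Z] minus_in[OF Z] Z unfolding A_def by fastforce
      qed
      have u_le: "u Z \<le> q Z" if "q \<in> C" for q Z
      proof (cases "Z \<in> H")
        case True
        then show ?thesis
          unfolding u_def by (intro cINF_lower bdd that)
      next
        case notin: False
        then have "(\<lambda>q. q Z) ` C = {0}"
          using CA False by (force simp: A_def)
        then show ?thesis
          using that CA notin by (auto simp: u_def A_def)
      qed
      have "sublinear u"
        unfolding u_def
      proof (rule sublinear_INF)
        fix i j Z W assume *: "i \<in> C" "j \<in> C" "Z \<in> H" "W \<in> H"
        \<comment> \<open>In a chain the smaller of the two functionals serves for both.\<close>
        then obtain k where k: "k \<in> C" "k \<le> i" "k \<le> j"
          using chain by blast
        have "k (\<lambda>\<omega>. Z \<omega> + W \<omega>) \<le> k Z + k W"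
          using k CA * by (intro sublinear_add) (auto simp: A_def)
        also have "\<dots> \<le> i Z + j W"
          using k by (intro add_mono) (auto simp: le_fun_def)
        finally show "\<exists>k\<in>C. k (\<lambda>\<omega>. Z \<omega> + W \<omega>) \<le> i Z + j W"
          using k by blast
      next
        fix i c Z assume "i \<in> C" "(c::real) > 0" "Z \<in> H"
        then show "\<exists>k\<in>C. k (\<lambda>\<omega>. c * Z \<omega>) \<le> c * i Z"
          using CA by (intro bexI[of _ i]) (auto simp: A_def sublinear_scale)
      qed (use False bdd in auto)
      moreover have "u X \<le> p X" if "X \<in> H" for X
      proof -
        obtain q where "q \<in> C" using False by auto
        then show ?thesis
          using u_le[of q X] CA that by (force simp: A_def)
      qed
      moreover have "u X = 0" if "X \<notin> H" for X
      proof -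
        have "(\<lambda>q. q X) ` C = {0}"
          using CA False that by (force simp: A_def)
        then show ?thesis by (simp add: u_def)
      qed
      ultimately have "u \<in> A" by (simp add: A_def)
      then show ?thesis using u_le by (auto simp: le_fun_def)
    qed
  qed
  then obtain q where q: "q \<in> A" and min: "\<And>r. r \<in> A \<Longrightarrow> r \<le> q \<Longrightarrow> r = q"
    by auto
  show thesis
  proof
    show "sublinear q" "\<And>X. X \<in> H \<Longrightarrow> q X \<le> p X"
      using q by (auto simp: A_def)
    have "r X = q X" if r: "sublinear r" "\<forall>X\<in>H. r X \<le> q X" and X: "X \<in> H" for r X
    proof -
      have "(\<lambda>X. if X \<in> H then r X else 0) = q"
      proof (rule min)
        show "(\<lambda>X. if X \<in> H then r X else 0) \<in> A"
          using r q by (auto simp: A_def intro: sublinear_cong[OF r(1)] order_trans)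
        show "(\<lambda>X. if X \<in> H then r X else 0) \<le> q"
          using r q by (auto simp: le_fun_def A_def)
      qed
      from fun_cong[OF this, of X] show ?thesis using X by simp
    qed
    then show "\<forall>r. sublinear r \<longrightarrow> (\<forall>X\<in>H. r X \<le> q X) \<longrightarrow> (\<forall>X\<in>H. r X = q X)"
      by blast
  qed
qed

text \<open>A minimal sublinear functional coincides with its tilts, which forces additivity.\<close>

lemma dominated_linear_exists:
  assumes p: "sublinear p"
  obtains f where "\<And>X. X \<in> H \<Longrightarrow> f X \<le> p X"
    "\<And>X Y. X \<in> H \<Longrightarrow> Y \<in> H \<Longrightarrow> f (\<lambda>\<omega>. X \<omega> + Y \<omega>) = f X + f Y"
    "\<And>c X. X \<in> H \<Longrightarrow> f (\<lambda>\<omega>. c * X \<omega>) = c * f X"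
proof -
  obtain q where q: "sublinear q" "\<And>X. X \<in> H \<Longrightarrow> q X \<le> p X"
    and min: "\<forall>r. sublinear r \<longrightarrow> (\<forall>X\<in>H. r X \<le> q X) \<longrightarrow> (\<forall>X\<in>H. r X = q X)"
    using minimal_sublinear_exists[OF p] by blast
  have add: "q (\<lambda>\<omega>. X \<omega> + Y \<omega>) = q X + q Y" if X: "X \<in> H" and Y: "Y \<in> H" for X Y
  proof -
    let ?r = "\<lambda>X. INF t\<in>{0::real..}. q (\<lambda>\<omega>. X \<omega> + t * Y \<omega>) - t * q Y"
    \<comment> \<open>The tilt lies below \<open>q\<close> by \<open>t = 0\<close>, hence equals it
      by minimality; \<open>t = 1\<close> then yields superadditivity.\<close>
    have "?r X = q X"
      using min[rule_format, OF sublinear_tilt(1)[OF q(1) Y] _ X]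
        sublinear_tilt(2)[OF q(1) Y, of _ 0] by simp
    then have "q X \<le> q (\<lambda>\<omega>. X \<omega> + Y \<omega>) - q Y"
      using sublinear_tilt(2)[OF q(1) Y X, of 1] by simp
    then show ?thesis
      using sublinear_add[OF q(1) X Y] by linarith
  qed
  have neg: "q (\<lambda>\<omega>. - X \<omega>) = - q X" if X: "X \<in> H" for X
    using add[OF X minus_in[OF X]] sublinear_zero[OF q(1)] by simp
  have scale: "q (\<lambda>\<omega>. c * X \<omega>) = c * q X" if X: "X \<in> H" for c X
  proof -
    consider "c > 0" | "c = 0" | "c < 0" by linarith
    then show ?thesis
    proof cases
      case 3
      then have "q (\<lambda>\<omega>. - c * X \<omega>) = - c * q X"
        by (intro sublinear_scale q X) auto
      then show ?thesis
        using neg[OF scale_in[OF X, of c]] by simp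
    qed (use sublinear_scale[OF q(1) X] sublinear_zero[OF q(1)] in auto)
  qed
  show thesis
    using that[of q] q(2) add scale by blast
qed

end

text \<open>First-order expansion of the norm with a quadratic remainder. It is the inequality
  between 2|z||z + y| and the sum of the squares, divided by 2|z|.\<close>

lemma norm_add_le_quadratic:
  fixes z y :: "'a :: real_inner"
  assumes "z \<noteq> 0"
  shows "norm (z + y) \<le> norm z + (z \<bullet> y) / norm z + (norm y)\<^sup>2 / (2 * norm z)"
proof -
  have "2 * norm z * norm (z + y) \<le> (norm z)\<^sup>2 + (norm (z + y))\<^sup>2"
    by (rule sum_squares_bound)
  also have "(norm (z + y))\<^sup>2 = (norm z)\<^sup>2 + 2 * (z \<bullet> y) + (norm y)\<^sup>2"
    by (simp add: power2_norm_eq_inner inner_add_left inner_add_right inner_commute)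
  finally show ?thesis
    using assms by (simp add: field_simps power2_eq_square)
qed

lemma lipschitz_affine:
  fixes g :: "'a :: real_normed_vector \<Rightarrow> 'b :: metric_space"
  assumes "L-lipschitz_on UNIV g"
  shows "(L * \<bar>a\<bar>)-lipschitz_on UNIV (\<lambda>y. g (s + a *\<^sub>R y))"
proof (rule lipschitz_onI)
  fix x y
  have "dist (s + a *\<^sub>R x) (s + a *\<^sub>R y) = \<bar>a\<bar> * dist x y"
    by (simp add: dist_norm scaleR_diff_right[symmetric])
  then show "dist (g (s + a *\<^sub>R x)) (g (s + a *\<^sub>R y)) \<le> L * \<bar>a\<bar> * dist x y"
    using lipschitz_onD[OF assms, of "s + a *\<^sub>R x" "s + a *\<^sub>R y"] by simp
qed (use lipschitz_on_nonneg[OF assms] in simp)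

text \<open>The mixing constant becomes a parameter, because it enters the final constant, which is
  fixed before \<phi> and n.\<close>

definition mixing_bound ::
    "(('w \<Rightarrow> real) \<Rightarrow> real) \<Rightarrow> real \<Rightarrow> (nat \<Rightarrow> 'w \<Rightarrow> real ^ 'd) \<Rightarrow> real \<Rightarrow> bool" where
  "mixing_bound E \<alpha> X c \<longleftrightarrow>
     (\<forall>\<Lambda>1 \<Lambda>2.
        finite \<Lambda>1 \<and> \<Lambda>1 \<noteq> {} \<and> \<Lambda>1 \<subseteq> {1..} \<and>
        finite \<Lambda>2 \<and> \<Lambda>2 \<noteq> {} \<and> \<Lambda>2 \<subseteq> {1..} \<and> Max \<Lambda>1 \<le> Min \<Lambda>2 \<longrightarrow>
        (\<forall>(\<phi> :: (real ^ 'd) \<times> (real ^ 'd) \<Rightarrow> real) l. l > 0 \<and> l-lipschitz_on UNIV \<phi> \<longrightarrow>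
           \<bar>E (\<lambda>\<omega>. \<phi> (avg X \<Lambda>1 \<omega>, avg X \<Lambda>2 \<omega>))
             - E (\<lambda>\<omega>. E (\<lambda>\<omega>'. \<phi> (avg X \<Lambda>1 \<omega>, avg X \<Lambda>2 \<omega>')))\<bar>
           \<le> c * l * exp (- \<alpha> * \<bar>real (Min \<Lambda>2) - real (Max \<Lambda>1)\<bar>)))"

lemma alpha_mixing_iff: "alpha_mixing E \<alpha> X \<longleftrightarrow> (\<exists>c>0. mixing_bound E \<alpha> X c)"
  by (simp only: alpha_mixing_def mixing_bound_def)

section \<open>Calculus of sublinear expectations, membership in \<open>H\<close>, and the smoothed
  norm\<close>

locale sublinear_space =
  fixes H :: "('w \<Rightarrow> real) set" and E :: "('w \<Rightarrow> real) \<Rightarrow> real"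
  assumes rv: "rv_space H" and sublin: "sublinear_expectation H E"

sublocale sublinear_space \<subseteq> function_space H
proof
  have "\<forall>c. (\<lambda>\<omega>. c) \<in> H"
    using rv unfolding rv_space_def by blast
  then show "(\<lambda>\<omega>. 0) \<in> H" by blast
qed (use rv in \<open>auto simp: rv_space_def\<close>)

context sublinear_space
begin

lemma const_in: "(\<lambda>\<omega>. c) \<in> H"
  using rv by (simp add: rv_space_def)

lemma C_lip_in:
  assumes "\<phi> \<in> C_lip n" "\<And>i. i < n \<Longrightarrow> X i \<in> H"
  shows "(\<lambda>\<omega>. \<phi> (\<lambda>i. X i \<omega>)) \<in> H"
proof -
  have "\<forall>n X. \<forall>\<phi>\<in>C_lip n. (\<forall>i<n. X i \<in> H) \<longrightarrow> (\<lambda>\<omega>. \<phi> (\<lambda>i. X i \<omega>)) \<in> H"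
    using rv by (simp add: rv_space_def)
  from this[rule_format, OF assms(1), of X] assms(2) show ?thesis by simp
qed

lemma E_mono: "X \<in> H \<Longrightarrow> Y \<in> H \<Longrightarrow> (\<And>\<omega>. X \<omega> \<le> Y \<omega>) \<Longrightarrow> E X \<le> E Y"
  using sublin unfolding sublinear_expectation_def by blast

lemma E_const: "E (\<lambda>\<omega>. c) = c"
  using sublin by (simp add: sublinear_expectation_def)

lemma E_add: "X \<in> H \<Longrightarrow> Y \<in> H \<Longrightarrow> E (\<lambda>\<omega>. X \<omega> + Y \<omega>) \<le> E X + E Y"
  using sublin unfolding sublinear_expectation_def by blast

lemma E_scale: "X \<in> H \<Longrightarrow> c \<ge> 0 \<Longrightarrow> E (\<lambda>\<omega>. c * X \<omega>) = c * E X"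
  using sublin unfolding sublinear_expectation_def by blast

lemma E_add_const:
  assumes X: "X \<in> H"
  shows "E (\<lambda>\<omega>. X \<omega> + c) = E X + c"
  using E_add[OF X const_in[of c]] E_add[OF add_in[OF X const_in[of c]] const_in[of "- c"]]
  by (simp add: E_const)

lemma E_diff:
  assumes "X \<in> H" "Y \<in> H" "Z \<in> H" "\<And>\<omega>. \<bar>X \<omega> - Y \<omega>\<bar> \<le> Z \<omega>"
  shows "\<bar>E X - E Y\<bar> \<le> E Z"
proof -
  have *: "E U \<le> E V + E Z" if "U \<in> H" "V \<in> H" "\<And>\<omega>. U \<omega> \<le> V \<omega> + Z \<omega>" for U V
    using E_mono[OF that(1) add_in[OF that(2) assms(3)] that(3)] E_add[OF that(2) assms(3)]
    by linarith
  have "X \<omega> \<le> Y \<omega> + Z \<omega>" "Y \<omega> \<le> X \<omega> + Z \<omega>" for \<omega>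
    using assms(4)[of \<omega>] by (auto simp: abs_le_iff)
  then show ?thesis
    using *[OF assms(1,2)] *[OF assms(2,1)] by (simp add: abs_le_iff)
qed

lemma sublinear_E: "sublinear E"
  by (simp add: sublinear_def E_add E_scale)

text \<open>Domination supplies the remaining axioms: for X \<le> Y, f (X - Y) \<le> E (X - Y) \<le>
  0, and the bounds at c and at -c together fix the value at constants.\<close>

lemma dominated_linear_in:
  assumes dom: "\<And>X. X \<in> H \<Longrightarrow> f X \<le> E X"
    and add: "\<And>X Y. X \<in> H \<Longrightarrow> Y \<in> H \<Longrightarrow> f (\<lambda>\<omega>. X \<omega> + Y \<omega>) = f X + f Y"
    and scale: "\<And>c X. X \<in> H \<Longrightarrow> f (\<lambda>\<omega>. c * X \<omega>) = c * f X"
  shows "f \<in> dominated_expectations H E"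
proof -
  have neg: "f (\<lambda>\<omega>. - X \<omega>) = - f X" if "X \<in> H" for X
    using scale[OF that, of "-1"] by simp
  have mono: "f X \<le> f Y" if XY: "X \<in> H" "Y \<in> H" "\<forall>\<omega>. X \<omega> \<le> Y \<omega>" for X Y
  proof -
    have D: "(\<lambda>\<omega>. X \<omega> - Y \<omega>) \<in> H" by (intro diff_in XY)
    have "f (\<lambda>\<omega>. X \<omega> - Y \<omega>) \<le> E (\<lambda>\<omega>. X \<omega> - Y \<omega>)"
      by (rule dom[OF D])
    also have "\<dots> \<le> E (\<lambda>\<omega>. 0)"
      using XY by (intro E_mono D zero_in) simp
    finally have "f (\<lambda>\<omega>. X \<omega> - Y \<omega>) \<le> 0" by (simp add: E_const)
    then show ?thesis
      using add[OF XY(1) minus_in[OF XY(2)]] neg[OF XY(2)] by simp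
  qed
  have const: "f (\<lambda>\<omega>. c) = c" for c
    using dom[OF const_in[of c]] dom[OF const_in[of "- c"]] neg[OF const_in[of c]]
    by (simp add: E_const)
  show ?thesis
    using mono const by (simp add: dominated_expectations_def linear_expectation_def
        sublinear_expectation_def add scale dom)
qed

text \<open>Closure of \<open>H\<close> is stated for functions of \<open>nat\<close>-indexed
  coordinates. An enumeration of the finite index type transports \<open>f\<close> to such a
  function without changing the Euclidean distance.\<close>

lemma lipschitz_in:
  fixes Y :: "'w \<Rightarrow> real ^ 'd"
  assumes Y: "random_vector H Y" and f: "L-lipschitz_on UNIV f"
  shows "(\<lambda>\<omega>. f (Y \<omega>)) \<in> H"
proof -
  obtain h :: "nat \<Rightarrow> 'd" where "bij_betw h {0..<CARD('d)} UNIV"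
    using ex_bij_betw_nat_finite[of "UNIV :: 'd set"] by auto
  then have h: "bij_betw h {..<CARD('d)} UNIV"
    by (simp add: atLeast0LessThan)
  define g where "g = inv_into {..<CARD('d)} h"
  have g: "bij_betw g UNIV {..<CARD('d)}" and hg: "h (g i) = i" for i
    using h by (auto simp: g_def bij_betw_inv_into bij_betw_inv_into_right)
  define \<phi> where "\<phi> z = f (\<chi> i. z (g i))" for z
  have "\<bar>\<phi> x - \<phi> y\<bar> \<le> L * L2_set (\<lambda>i. x i - y i) {..<CARD('d)}" for x y
  proof -
    have "\<bar>\<phi> x - \<phi> y\<bar> \<le> L * dist (\<chi> i. x (g i)) (\<chi> i. y (g i))"
      using lipschitz_onD[OF f] by (simp add: \<phi>_def dist_real_def)
    also have "dist (\<chi> i. x (g i)) (\<chi> i. y (g i)) = L2_set (\<lambda>i. x (g i) - y (g i)) UNIV"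
      by (simp add: dist_norm norm_vec_def L2_set_def)
    also have "\<dots> = L2_set (\<lambda>i. x i - y i) {..<CARD('d)}"
      unfolding L2_set_def using sum.reindex_bij_betw[OF g, of "\<lambda>i. (x i - y i)\<^sup>2"] by simp
    finally show ?thesis .
  qed
  then have "\<phi> \<in> C_lip CARD('d)" by (auto simp: C_lip_def)
  then have "(\<lambda>\<omega>. \<phi> (\<lambda>i. Y \<omega> $ h i)) \<in> H"
    using Y C_lip_in[of \<phi> "CARD('d)" "\<lambda>i \<omega>. Y \<omega> $ h i"] by (simp add: random_vector_def)
  then show ?thesis by (simp add: \<phi>_def hg)
qed

lemma random_vector_sum:
  "(\<And>i. i \<in> I \<Longrightarrow> random_vector H (Y i)) \<Longrightarrow> random_vector H (\<lambda>\<omega>. \<Sum>i\<in>I. Y i \<omega>)"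
proof (induction I rule: infinite_finite_induct)
  case (insert x F)
  then show ?case by (simp add: random_vector_def add_in)
qed (auto simp: random_vector_def zero_in)

lemma inner_in:
  assumes "random_vector H Y"
  shows "(\<lambda>\<omega>. p \<bullet> Y \<omega>) \<in> H"
proof (rule lipschitz_in[OF assms])
  show "(norm p)-lipschitz_on UNIV ((\<bullet>) p)"
    by (rule lipschitz_onI)
      (auto simp: dist_norm inner_diff_right[symmetric] Cauchy_Schwarz_ineq2)
qed

lemma norm_in:
  assumes "random_vector H Y"
  shows "(\<lambda>\<omega>. norm (Y \<omega>)) \<in> H"
  by (rule lipschitz_in[OF assms, of 1]) (auto intro!: lipschitz_onI simp: dist_norm norm_triangle_ineq3)


text \<open>The norm of the pair \<open>(\<epsilon>, v)\<close> is the square root of \<epsilon>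
  squared plus |v| squared. Written as a norm in a product space it is visibly 1-Lipschitz in v, and
  the quadratic expansion of the norm applies to it.\<close>

lemma smoothed_norm_in:
  fixes Y :: "'w \<Rightarrow> real ^ 'd"
  assumes Y: "random_vector H Y"
  shows "(\<lambda>\<omega>. norm (\<epsilon> :: real, v + a *\<^sub>R (Y \<omega> - k))) \<in> H"
proof -
  have "1-lipschitz_on UNIV (\<lambda>y :: real ^ 'd. norm (\<epsilon>, y))"
  proof (rule lipschitz_onI)
    fix x y :: "real ^ 'd"
    have "\<bar>norm (\<epsilon>, x) - norm (\<epsilon>, y)\<bar> \<le> norm ((\<epsilon>, x) - (\<epsilon>, y))"
      by (rule norm_triangle_ineq3)
    then show "dist (norm (\<epsilon>, x)) (norm (\<epsilon>, y)) \<le> 1 * dist x y"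
      by (simp add: dist_norm norm_Pair)
  qed simp
  from lipschitz_in[OF Y lipschitz_affine[OF this, of a "v - a *\<^sub>R k"]]
  show ?thesis
    by (simp add: algebra_simps)
qed

text \<open>Expand the norm at \<open>(\<epsilon>, v)\<close> with increment
  \<open>(0, a *\<^sub>R (Y - k))\<close>. The hypothesis on the direction v makes the expected
  linear term nonpositive, and the quadratic remainder has a denominator of at least 2\<epsilon>,
  since the pair has norm at least \<epsilon>.\<close>

lemma E_smoothed_norm:
  fixes Y :: "'w \<Rightarrow> real ^ 'd" and k v :: "real ^ 'd"
  assumes Y: "random_vector H Y" and Q: "(\<lambda>\<omega>. (abs_vec (Y \<omega>))\<^sup>2) \<in> H"
    and \<epsilon>: "\<epsilon> > 0" and a: "a \<ge> 0" and R: "norm k \<le> R"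
    and dir: "E (\<lambda>\<omega>. v \<bullet> Y \<omega>) \<le> v \<bullet> k"
  shows "E (\<lambda>\<omega>. norm (\<epsilon>, v + a *\<^sub>R (Y \<omega> - k)))
    \<le> norm (\<epsilon>, v) + a\<^sup>2 * (E (\<lambda>\<omega>. (abs_vec (Y \<omega>))\<^sup>2) + R\<^sup>2) / \<epsilon>"
proof -
  define h where "h = norm (\<epsilon>, v)"
  have h: "\<epsilon> \<le> h"
    using \<epsilon> norm_fst_le[of \<epsilon> v] by (simp add: h_def)
  define c where "c = h - a / h * (v \<bullet> k) + a\<^sup>2 * R\<^sup>2 / \<epsilon>"
  have pt: "norm (\<epsilon>, v + a *\<^sub>R (Y \<omega> - k))
      \<le> (a / h * (v \<bullet> Y \<omega>) + a\<^sup>2 / \<epsilon> * (abs_vec (Y \<omega>))\<^sup>2) + c" for \<omega>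
  proof -
    let ?y = "a *\<^sub>R (Y \<omega> - k)"
    \<comment> \<open>The Euclidean norm is replaced by \<open>abs_vec\<close>, whose square is
      known to lie in \<open>H\<close>.\<close>
    have "norm (Y \<omega> - k) \<le> abs_vec (Y \<omega>) + R"
      using norm_triangle_ineq4[of "Y \<omega>" k] R norm_le_l1_cart[of "Y \<omega>"]
      by (simp add: abs_vec_def)
    then have "(norm (Y \<omega> - k))\<^sup>2 \<le> (abs_vec (Y \<omega>) + R)\<^sup>2"
      by (intro power_mono) auto
    also have "\<dots> \<le> 2 * ((abs_vec (Y \<omega>))\<^sup>2 + R\<^sup>2)"
      using sum_squares_bound[of "abs_vec (Y \<omega>)" R] by (simp add: power2_sum)
    finally have "(norm ?y)\<^sup>2 \<le> a\<^sup>2 * (2 * ((abs_vec (Y \<omega>))\<^sup>2 + R\<^sup>2))"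
      by (simp add: power_mult_distrib mult_left_mono)
    then have "(norm ?y)\<^sup>2 / (2 * h) \<le> a\<^sup>2 * (2 * ((abs_vec (Y \<omega>))\<^sup>2 + R\<^sup>2)) / (2 * \<epsilon>)"
      using \<epsilon> h by (intro frac_le) auto
    moreover have "norm ((\<epsilon>, v) + (0, ?y)) \<le> norm (\<epsilon>, v) + ((\<epsilon>, v) \<bullet> (0, ?y)) / norm (\<epsilon>, v)
        + (norm ((0::real), ?y))\<^sup>2 / (2 * norm (\<epsilon>, v))"
      using \<epsilon> by (intro norm_add_le_quadratic) (auto simp: zero_prod_def)
    ultimately have "norm (\<epsilon>, v + ?y) \<le> h + (v \<bullet> ?y) / h
        + a\<^sup>2 * (2 * ((abs_vec (Y \<omega>))\<^sup>2 + R\<^sup>2)) / (2 * \<epsilon>)"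
      by (simp add: h_def norm_Pair)
    also have "\<dots> = (a / h * (v \<bullet> Y \<omega>) + a\<^sup>2 / \<epsilon> * (abs_vec (Y \<omega>))\<^sup>2) + c"
      using \<epsilon> h by (simp add: c_def inner_diff_right field_simps)
    finally show ?thesis .
  qed
  have L: "(\<lambda>\<omega>. norm (\<epsilon>, v + a *\<^sub>R (Y \<omega> - k))) \<in> H"
    by (rule smoothed_norm_in[OF Y])
  have I: "(\<lambda>\<omega>. v \<bullet> Y \<omega>) \<in> H" by (rule inner_in[OF Y])
  note I' = scale_in[OF I, of "a / h"] and Q' = scale_in[OF Q, of "a\<^sup>2 / \<epsilon>"]
  have "E (\<lambda>\<omega>. norm (\<epsilon>, v + a *\<^sub>R (Y \<omega> - k)))
      \<le> E (\<lambda>\<omega>. (a / h * (v \<bullet> Y \<omega>) + a\<^sup>2 / \<epsilon> * (abs_vec (Y \<omega>))\<^sup>2) + c)"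
    by (rule E_mono[OF L add_in[OF add_in[OF I' Q'] const_in] pt])
  also have "\<dots> = E (\<lambda>\<omega>. a / h * (v \<bullet> Y \<omega>) + a\<^sup>2 / \<epsilon> * (abs_vec (Y \<omega>))\<^sup>2) + c"
    by (rule E_add_const[OF add_in[OF I' Q']])
  also have "\<dots> \<le> a / h * E (\<lambda>\<omega>. v \<bullet> Y \<omega>) + a\<^sup>2 / \<epsilon> * E (\<lambda>\<omega>. (abs_vec (Y \<omega>))\<^sup>2) + c"
    using E_add[OF I' Q'] E_scale[OF I, of "a / h"] E_scale[OF Q, of "a\<^sup>2 / \<epsilon>"] a \<epsilon> h by simp
  also have "\<dots> \<le> a / h * (v \<bullet> k) + a\<^sup>2 / \<epsilon> * E (\<lambda>\<omega>. (abs_vec (Y \<omega>))\<^sup>2) + c"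
    using dir a \<epsilon> h by (intro add_right_mono mult_left_mono) auto
  also have "\<dots> = h + a\<^sup>2 * (E (\<lambda>\<omega>. (abs_vec (Y \<omega>))\<^sup>2) + R\<^sup>2) / \<epsilon>"
    by (simp add: c_def distrib_left add_divide_distrib)
  finally show ?thesis by (simp add: h_def)
qed

section \<open>The set of means as an intersection of half-spaces\<close>

definition support_set :: "('w \<Rightarrow> real ^ 'd) \<Rightarrow> (real ^ 'd) set" where
  "support_set Y = {x. \<forall>p. p \<bullet> x \<le> E (\<lambda>\<omega>. p \<bullet> Y \<omega>)}"

text \<open>Makes the whole calculus available for a dominated linear expectation; the lower bound
  on the iterates relies on this.\<close>

lemma dominated_sublinear_space:
  "P \<in> dominated_expectations H E \<Longrightarrow> sublinear_space H P"
  using rv by (simp add: sublinear_space_def dominated_expectations_def linear_expectation_def)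

lemma expectation_inner:
  assumes P: "P \<in> dominated_expectations H E" and Y: "random_vector H Y"
  shows "P (\<lambda>\<omega>. p \<bullet> Y \<omega>) = p \<bullet> expectation_vec P Y"
proof -
  \<comment> \<open>Membership of the partial sums is carried through the induction, because
    additivity holds on \<open>H\<close> only.\<close>
  have "(\<lambda>\<omega>. \<Sum>i\<in>I. p $ i * Y \<omega> $ i) \<in> H \<and>
      P (\<lambda>\<omega>. \<Sum>i\<in>I. p $ i * Y \<omega> $ i) = (\<Sum>i\<in>I. p $ i * P (\<lambda>\<omega>. Y \<omega> $ i))" for I
  proof (induction I rule: infinite_finite_induct)
    case (insert i I)
    have Yi: "(\<lambda>\<omega>. p $ i * Y \<omega> $ i) \<in> H"
      using Y by (simp add: random_vector_def scale_in)
    have lin: "P (\<lambda>\<omega>. U \<omega> + V \<omega>) = P U + P V" if "U \<in> H" "V \<in> H" for U V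
      using P that unfolding dominated_expectations_def linear_expectation_def by blast
    have "P (\<lambda>\<omega>. p $ i * Y \<omega> $ i) = p $ i * P (\<lambda>\<omega>. Y \<omega> $ i)"
      using P Y by (simp add: random_vector_def dominated_expectations_def linear_expectation_def)
    then show ?case
      using insert lin[OF Yi conjunct1[OF insert.IH]] add_in[OF Yi conjunct1[OF insert.IH]] by simp
  qed (use P zero_in in \<open>auto simp: dominated_expectations_def linear_expectation_def
      sublinear_expectation_def\<close>)
  then show ?thesis by (simp add: inner_vec_def expectation_vec_def)
qed

lemma mean_set_subset_support_set:
  assumes "random_vector H Y"
  shows "mean_set H E Y \<subseteq> support_set Y"
proof
  fix x assume "x \<in> mean_set H E Y"
  then obtain P where P: "P \<in> dominated_expectations H E" and x: "x = expectation_vec P Y"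
    by (auto simp: mean_set_def)
  have "p \<bullet> x \<le> E (\<lambda>\<omega>. p \<bullet> Y \<omega>)" for p
  proof -
    have "P (\<lambda>\<omega>. p \<bullet> Y \<omega>) \<le> E (\<lambda>\<omega>. p \<bullet> Y \<omega>)"
      using P inner_in[OF assms, of p] by (simp add: dominated_expectations_def)
    then show ?thesis by (simp add: x expectation_inner[OF P assms])
  qed
  then show "x \<in> support_set Y" by (simp add: support_set_def)
qed

text \<open>A linear functional below the infimum in the proof annihilates every \<open>p \<bullet> (Y - x)\<close>.\<close>

lemma support_set_subset_mean_set:
  fixes Y :: "'w \<Rightarrow> real ^ 'd"
  assumes Y: "random_vector H Y"
  shows "support_set Y \<subseteq> mean_set H E Y"
proof
  fix x assume "x \<in> support_set Y"
  then have x: "p \<bullet> x \<le> E (\<lambda>\<omega>. p \<bullet> Y \<omega>)" for p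
    by (simp add: support_set_def)
  let ?F = "\<lambda>p Z. E (\<lambda>\<omega>. Z \<omega> + p \<bullet> Y \<omega>) - p \<bullet> x"
  define q where "q Z = (INF p. ?F p Z)" for Z
  \<comment> \<open>This is where membership of x in the support set enters:
    \<open>p \<bullet> x \<le> E (p \<bullet> Y)\<close> keeps the infimum over all p
    finite.\<close>
  have low: "- E (\<lambda>\<omega>. - Z \<omega>) \<le> ?F p Z" if Z: "Z \<in> H" for Z p
    using E_add[OF add_in[OF Z inner_in[OF Y, of p]] minus_in[OF Z]] x[of p] by simp
  have bdd: "bdd_below (range (\<lambda>p. ?F p Z))" if "Z \<in> H" for Z
    using low[OF that] by (rule bdd_belowI2)
  have q_le: "q Z \<le> ?F p Z" if "Z \<in> H" for Z p
    unfolding q_def by (intro cINF_lower bdd that) auto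
  have "sublinear q"
    unfolding q_def
  proof (rule sublinear_INF)
    fix i j :: "real ^ 'd" and Z W assume ZW: "Z \<in> H" "W \<in> H"
    have "E (\<lambda>\<omega>. (Z \<omega> + i \<bullet> Y \<omega>) + (W \<omega> + j \<bullet> Y \<omega>))
        \<le> E (\<lambda>\<omega>. Z \<omega> + i \<bullet> Y \<omega>) + E (\<lambda>\<omega>. W \<omega> + j \<bullet> Y \<omega>)"
      by (intro E_add add_in inner_in Y ZW)
    then have "?F (i + j) (\<lambda>\<omega>. Z \<omega> + W \<omega>) \<le> ?F i Z + ?F j W"
      by (simp add: algebra_simps)
    then show "\<exists>k\<in>UNIV. ?F k (\<lambda>\<omega>. Z \<omega> + W \<omega>) \<le> ?F i Z + ?F j W" by blast
  next
    fix i :: "real ^ 'd" and c :: real and Z assume *: "c > 0" "Z \<in> H"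
    have "E (\<lambda>\<omega>. c * (Z \<omega> + i \<bullet> Y \<omega>)) = c * E (\<lambda>\<omega>. Z \<omega> + i \<bullet> Y \<omega>)"
      using * by (intro E_scale add_in inner_in Y) auto
    then have "?F (c *\<^sub>R i) (\<lambda>\<omega>. c * Z \<omega>) \<le> c * ?F i Z"
      by (simp add: algebra_simps)
    then show "\<exists>k\<in>UNIV. ?F k (\<lambda>\<omega>. c * Z \<omega>) \<le> c * ?F i Z" by blast
  qed (use bdd in auto)
  then obtain f where f: "\<And>X. X \<in> H \<Longrightarrow> f X \<le> q X"
    "\<And>X Y. X \<in> H \<Longrightarrow> Y \<in> H \<Longrightarrow> f (\<lambda>\<omega>. X \<omega> + Y \<omega>) = f X + f Y"
    "\<And>c X. X \<in> H \<Longrightarrow> f (\<lambda>\<omega>. c * X \<omega>) = c * f X"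
    by (rule dominated_linear_exists) blast
  have "f X \<le> E X" if "X \<in> H" for X
    using f(1)[OF that] q_le[OF that, of 0] by simp
  then have P: "f \<in> dominated_expectations H E"
    using f(2,3) by (rule dominated_linear_in)
  \<comment> \<open>The shift by \<open>- p\<close> cancels \<open>p \<bullet> Y\<close> inside E.
    Choosing p as the difference of the two points then makes its squared norm nonpositive.\<close>
  have "p \<bullet> (expectation_vec f Y - x) \<le> 0" for p
  proof -
    have "p \<bullet> expectation_vec f Y = f (\<lambda>\<omega>. p \<bullet> Y \<omega>)"
      by (rule expectation_inner[OF P Y, symmetric])
    also have "\<dots> \<le> q (\<lambda>\<omega>. p \<bullet> Y \<omega>)" by (intro f inner_in Y)
    also have "\<dots> \<le> p \<bullet> x"
      using q_le[OF inner_in[OF Y, of p], of "- p"] E_const[of 0] by simp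
    finally show ?thesis by (simp add: inner_diff_right)
  qed
  from this[of "expectation_vec f Y - x"] have "expectation_vec f Y - x = 0"
    using inner_gt_zero_iff[of "expectation_vec f Y - x"] by linarith
  then have "expectation_vec f Y = x" by simp
  then show "x \<in> mean_set H E Y"
    using P by (auto simp: mean_set_def)
qed

text \<open>Membership in \<Gamma> becomes a family of linear inequalities, from which compactness
  can be read off and which the induction on the iterates can propagate.\<close>

lemma mean_set_eq_support_set:
  "random_vector H Y \<Longrightarrow> mean_set H E Y = support_set Y"
  using mean_set_subset_support_set support_set_subset_mean_set by blast

text \<open>A linear functional below the tilt of E in the direction \<open>v \<bullet> Y\<close>
  agrees with E there; k is its mean vector.\<close>

lemma support_set_attains:
  assumes Y: "random_vector H Y"
  obtains k where "k \<in> support_set Y" "E (\<lambda>\<omega>. v \<bullet> Y \<omega>) = v \<bullet> k"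
proof -
  let ?V = "\<lambda>\<omega>. v \<bullet> Y \<omega>"
  let ?q = "\<lambda>X. INF t\<in>{0::real..}. E (\<lambda>\<omega>. X \<omega> + t * ?V \<omega>) - t * E ?V"
  note V = inner_in[OF Y, of v]
  obtain f where f: "\<And>X. X \<in> H \<Longrightarrow> f X \<le> ?q X"
    "\<And>X Y. X \<in> H \<Longrightarrow> Y \<in> H \<Longrightarrow> f (\<lambda>\<omega>. X \<omega> + Y \<omega>) = f X + f Y"
    "\<And>c X. X \<in> H \<Longrightarrow> f (\<lambda>\<omega>. c * X \<omega>) = c * f X"
    using sublinear_tilt(1)[OF sublinear_E V] by (rule dominated_linear_exists) blast
  have le: "f X \<le> E (\<lambda>\<omega>. X \<omega> + t * ?V \<omega>) - t * E ?V" if "X \<in> H" "t \<ge> 0" for X t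
    using f(1)[OF that(1)] sublinear_tilt(2)[OF sublinear_E V that] by linarith
  have dom: "f X \<le> E X" if "X \<in> H" for X
    using le[OF that, of 0] by simp
  then have P: "f \<in> dominated_expectations H E"
    using f(2,3) by (rule dominated_linear_in)
  have "f (\<lambda>\<omega>. - ?V \<omega>) \<le> - E ?V"
    using le[OF minus_in[OF V], of 1] by (simp add: E_const)
  then have "E ?V \<le> f ?V"
    using f(3)[OF V, of "-1"] by simp
  then have "E ?V = v \<bullet> expectation_vec f Y"
    using dom[OF V] expectation_inner[OF P Y, of v] by simp
  moreover have "expectation_vec f Y \<in> support_set Y"
    using mean_set_subset_support_set[OF Y] P by (auto simp: mean_set_def)
  ultimately show thesis using that by blast
qed

text \<open>Test the defining inequality with p = x and apply Cauchy-Schwarz.\<close>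

lemma support_set_norm_le:
  assumes Y: "random_vector H Y" and x: "x \<in> support_set Y"
  shows "norm x \<le> E (\<lambda>\<omega>. norm (Y \<omega>))"
proof (cases "x = 0")
  case True
  then show ?thesis
    using E_mono[OF zero_in norm_in[OF Y]] by (simp add: E_const)
next
  case False
  have "norm x * norm x \<le> E (\<lambda>\<omega>. x \<bullet> Y \<omega>)"
    using x by (simp add: support_set_def norm_eq_sqrt_inner)
  also have "\<dots> \<le> E (\<lambda>\<omega>. norm x * norm (Y \<omega>))"
    by (intro E_mono inner_in scale_in norm_in Y norm_cauchy_schwarz)
  also have "\<dots> = norm x * E (\<lambda>\<omega>. norm (Y \<omega>))"
    by (intro E_scale norm_in Y) simp
  finally show ?thesis using False by simp
qed

lemma compact_support_set:
  assumes "random_vector H Y"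
  shows "compact (support_set Y)"
proof -
  have "support_set Y = (\<Inter>p. {x. p \<bullet> x \<le> E (\<lambda>\<omega>. p \<bullet> Y \<omega>)})"
    by (auto simp: support_set_def)
  then have "closed (support_set Y)"
    by (simp add: closed_INT closed_halfspace_le)
  moreover have "bounded (support_set Y)"
    using support_set_norm_le[OF assms] by (auto simp: bounded_iff)
  ultimately show ?thesis by (simp add: compact_eq_bounded_closed)
qed

section \<open>The one-step operator, bounds on its iterates, and the passage from the mixing
  sequence to it\<close>

definition step :: "('w \<Rightarrow> real ^ 'd) \<Rightarrow> real \<Rightarrow> (real ^ 'd \<Rightarrow> real) \<Rightarrow> real ^ 'd \<Rightarrow> real" where
  "step Y a g s = E (\<lambda>\<omega>. g (s + a *\<^sub>R Y \<omega>))"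

lemma affine_in:
  "random_vector H Y \<Longrightarrow> L-lipschitz_on UNIV g \<Longrightarrow> (\<lambda>\<omega>. g (s + a *\<^sub>R Y \<omega>)) \<in> H"
  using lipschitz_in lipschitz_affine by blast

text \<open>The Lipschitz constant does not grow, so iterates stay within \<open>H\<close> and every
  mixing step can be charged with the same l.\<close>

lemma step_lipschitz:
  fixes Y :: "'w \<Rightarrow> real ^ 'd"
  assumes Y: "random_vector H Y" and g: "L-lipschitz_on UNIV g"
  shows "L-lipschitz_on UNIV (step Y a g)"
proof (rule lipschitz_onI)
  fix s t :: "real ^ 'd"
  have "\<bar>step Y a g s - step Y a g t\<bar> \<le> E (\<lambda>\<omega>. L * dist s t)"
    unfolding step_def
  proof (rule E_diff)
    show "\<bar>g (s + a *\<^sub>R Y \<omega>) - g (t + a *\<^sub>R Y \<omega>)\<bar> \<le> L * dist s t" for \<omega>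
      using lipschitz_onD[OF g, of "s + a *\<^sub>R Y \<omega>" "t + a *\<^sub>R Y \<omega>"] by (simp add: dist_real_def)
  qed (intro affine_in[OF Y g] const_in)+
  then show "dist (step Y a g s) (step Y a g t) \<le> L * dist s t"
    by (simp add: E_const dist_real_def)
qed (rule lipschitz_on_nonneg[OF g])

lemma step_iterate_lipschitz:
  assumes "random_vector H Y" "L-lipschitz_on UNIV g"
  shows "L-lipschitz_on UNIV ((step Y a ^^ j) g)"
  using assms by (induction j) (auto intro: step_lipschitz)

text \<open>The point \<open>\<pi>\<close> ranges over \<open>1 - j * a\<close> times the support set: at each step it moves by
  \<open>a *\<^sub>R k\<close>, where \<open>k\<close> maximises the linear term of the expansion of the smoothed norm.\<close>

lemma step_iterate_upper:
  fixes Y :: "'w \<Rightarrow> real ^ 'd" and s \<pi> :: "real ^ 'd"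
  assumes Y: "random_vector H Y" and Q: "(\<lambda>\<omega>. (abs_vec (Y \<omega>))\<^sup>2) \<in> H"
    and \<epsilon>: "\<epsilon> > 0" and a: "a \<ge> 0"
    and \<phi>: "l-lipschitz_on UNIV \<phi>" and M: "\<And>x. x \<in> support_set Y \<Longrightarrow> \<phi> x \<le> M"
    and R: "\<And>x. x \<in> support_set Y \<Longrightarrow> norm x \<le> R"
  defines "b \<equiv> a\<^sup>2 * (E (\<lambda>\<omega>. (abs_vec (Y \<omega>))\<^sup>2) + R\<^sup>2) / \<epsilon>"
  assumes "\<And>p. p \<bullet> \<pi> \<le> (1 - real j * a) * E (\<lambda>\<omega>. p \<bullet> Y \<omega>)"
  shows "(step Y a ^^ j) \<phi> s \<le> M + l * (norm (\<epsilon>, s - \<pi>) + real j * b)"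
  using assms(9)
proof (induction j arbitrary: s \<pi>)
  case 0
  \<comment> \<open>For j = 0 the factor is 1, and the hypothesis on \<pi> says that it lies in the
    support set.\<close>
  then have "\<phi> \<pi> \<le> M"
    by (intro M) (simp add: support_set_def)
  moreover have "\<phi> s \<le> \<phi> \<pi> + l * norm (s - \<pi>)"
    using lipschitz_onD[OF \<phi>, of s \<pi>] by (simp add: dist_norm)
  moreover have "l * norm (s - \<pi>) \<le> l * norm (\<epsilon>, s - \<pi>)"
    using lipschitz_on_nonneg[OF \<phi>] norm_snd_le[of "s - \<pi>" \<epsilon>] by (intro mult_left_mono)
  ultimately show ?case by simp
next
  case (Suc j)
  have l: "l \<ge> 0" by (rule lipschitz_on_nonneg[OF \<phi>])
  \<comment> \<open>Attaining the support function in the direction s - \<pi> removes the linear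
    term, and moving \<pi> by a k turns the factor 1 - (j + 1) a into 1 - j a.\<close>
  obtain k where k: "k \<in> support_set Y" "E (\<lambda>\<omega>. (s - \<pi>) \<bullet> Y \<omega>) = (s - \<pi>) \<bullet> k"
    using support_set_attains[OF Y] by blast
  let ?N = "\<lambda>\<omega>. norm (\<epsilon>, (s - \<pi>) + a *\<^sub>R (Y \<omega> - k))"
  have "p \<bullet> (\<pi> + a *\<^sub>R k) \<le> (1 - real j * a) * E (\<lambda>\<omega>. p \<bullet> Y \<omega>)" for p
  proof -
    have "a * (p \<bullet> k) \<le> a * E (\<lambda>\<omega>. p \<bullet> Y \<omega>)"
      using k(1) a by (intro mult_left_mono) (simp_all add: support_set_def)
    then show ?thesis
      using Suc.prems[of p] by (simp add: inner_add_right algebra_simps)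
  qed
  note IH = Suc.IH[OF this]
  have pt: "(step Y a ^^ j) \<phi> (s + a *\<^sub>R Y \<omega>) \<le> l * ?N \<omega> + (M + l * (real j * b))" for \<omega>
  proof -
    have "s + a *\<^sub>R Y \<omega> - (\<pi> + a *\<^sub>R k) = (s - \<pi>) + a *\<^sub>R (Y \<omega> - k)"
      by (simp add: algebra_simps)
    then show ?thesis
      using IH[of "s + a *\<^sub>R Y \<omega>"] by (simp only: distrib_left)
  qed
  have N: "?N \<in> H" by (rule smoothed_norm_in[OF Y])
  have "(step Y a ^^ Suc j) \<phi> s = E (\<lambda>\<omega>. (step Y a ^^ j) \<phi> (s + a *\<^sub>R Y \<omega>))"
    by (simp add: step_def)
  also have "\<dots> \<le> E (\<lambda>\<omega>. l * ?N \<omega> + (M + l * (real j * b)))"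
    by (rule E_mono[OF affine_in[OF Y step_iterate_lipschitz[OF Y \<phi>]]
          add_in[OF scale_in[OF N] const_in] pt])
  also have "\<dots> = l * E ?N + (M + l * (real j * b))"
    using E_add_const[OF scale_in[OF N]] E_scale[OF N l] by simp
  also have "\<dots> \<le> l * (norm (\<epsilon>, s - \<pi>) + b) + (M + l * (real j * b))"
    unfolding b_def
    using k by (intro add_right_mono mult_left_mono l E_smoothed_norm Y Q \<epsilon> a R) auto
  finally show ?case by (simp add: algebra_simps)
qed

text \<open>One linear expectation P \<le> E with mean x serves at every step: P (v \<bullet> Y) = v
  \<bullet> x for all v, so the linear term vanishes whatever the current position, and the
  reference point moves along multiples of x.\<close>

lemma step_iterate_lower:
  fixes Y :: "'w \<Rightarrow> real ^ 'd" and s x :: "real ^ 'd"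
  assumes Y: "random_vector H Y" and Q: "(\<lambda>\<omega>. (abs_vec (Y \<omega>))\<^sup>2) \<in> H"
    and \<epsilon>: "\<epsilon> > 0" and a: "a \<ge> 0"
    and \<phi>: "l-lipschitz_on UNIV \<phi>" and x: "x \<in> mean_set H E Y" and R: "norm x \<le> R"
  defines "b \<equiv> a\<^sup>2 * (E (\<lambda>\<omega>. (abs_vec (Y \<omega>))\<^sup>2) + R\<^sup>2) / \<epsilon>"
  shows "\<phi> x - l * (norm (\<epsilon>, s - (1 - real j * a) *\<^sub>R x) + real j * b) \<le> (step Y a ^^ j) \<phi> s"
proof (induction j arbitrary: s)
  case 0
  have "\<phi> x - l * norm (s - x) \<le> \<phi> s"
    using lipschitz_onD[OF \<phi>, of s x] by (simp add: dist_norm dist_real_def abs_le_iff)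
  moreover have "l * norm (s - x) \<le> l * norm (\<epsilon>, s - x)"
    using lipschitz_on_nonneg[OF \<phi>] norm_snd_le[of "s - x" \<epsilon>] by (intro mult_left_mono)
  ultimately show ?case by simp
next
  case (Suc j)
  obtain P where P: "P \<in> dominated_expectations H E" and xP: "x = expectation_vec P Y"
    using x by (auto simp: mean_set_def)
  interpret P: sublinear_space H P
    by (rule dominated_sublinear_space[OF P])
  have dom: "P Z \<le> E Z" and P_scale: "P (\<lambda>\<omega>. c * Z \<omega>) = c * P Z" if "Z \<in> H" for Z c
    using P that by (auto simp: dominated_expectations_def linear_expectation_def)
  have l: "l \<ge> 0" by (rule lipschitz_on_nonneg[OF \<phi>])
  define v where "v = s - (1 - real (Suc j) * a) *\<^sub>R x"
  let ?N = "\<lambda>\<omega>. norm (\<epsilon>, v + a *\<^sub>R (Y \<omega> - x))"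
  let ?d = "\<phi> x - l * (real j * b)"
  have N: "?N \<in> H" by (rule smoothed_norm_in[OF Y])
  have S: "(\<lambda>\<omega>. (step Y a ^^ j) \<phi> (s + a *\<^sub>R Y \<omega>)) \<in> H"
    by (rule affine_in[OF Y step_iterate_lipschitz[OF Y \<phi>]])
  have pt: "- l * ?N \<omega> + ?d \<le> (step Y a ^^ j) \<phi> (s + a *\<^sub>R Y \<omega>)" for \<omega>
  proof -
    have "s + a *\<^sub>R Y \<omega> - (1 - real j * a) *\<^sub>R x = v + a *\<^sub>R (Y \<omega> - x)"
      by (simp add: v_def algebra_simps)
    then show ?thesis
      using Suc.IH[of "s + a *\<^sub>R Y \<omega>"] by (simp only: distrib_left)
  qed
  have "P ?N \<le> norm (\<epsilon>, v) + a\<^sup>2 * (P (\<lambda>\<omega>. (abs_vec (Y \<omega>))\<^sup>2) + R\<^sup>2) / \<epsilon>"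
    by (rule P.E_smoothed_norm[OF Y Q \<epsilon> a R]) (simp add: expectation_inner[OF P Y] xP)
  also have "\<dots> \<le> norm (\<epsilon>, v) + b"
    unfolding b_def using \<epsilon> dom[OF Q] by (intro add_left_mono divide_right_mono mult_left_mono) auto
  finally have "l * P ?N \<le> l * (norm (\<epsilon>, v) + b)"
    using l by (rule mult_left_mono)
  then have "\<phi> x - l * (norm (\<epsilon>, v) + real (Suc j) * b) \<le> - l * P ?N + ?d"
    by (simp add: algebra_simps)
  \<comment> \<open>Linearity of P allows the negative factor -l to be pulled out.\<close>
  also have "\<dots> = P (\<lambda>\<omega>. - l * ?N \<omega> + ?d)"
    using P.E_add_const[OF scale_in[OF N, of "- l"], of ?d] P_scale[OF N, of "- l"] by simp
  also have "\<dots> \<le> P (\<lambda>\<omega>. (step Y a ^^ j) \<phi> (s + a *\<^sub>R Y \<omega>))"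
    by (rule P.E_mono[OF add_in[OF scale_in[OF N] const_in] S pt])
  also have "\<dots> \<le> E (\<lambda>\<omega>. (step Y a ^^ j) \<phi> (s + a *\<^sub>R Y \<omega>))"
    by (rule dom[OF S])
  also have "\<dots> = (step Y a ^^ Suc j) \<phi> s"
    by (simp add: step_def)
  finally show ?case by (simp add: v_def)
qed

text \<open>Mixing replaces the last summand by an independent copy of \<open>X 1\<close>, at a cost that decays
  exponentially in the gap before it.\<close>

lemma mixing_iterate:
  fixes X :: "nat \<Rightarrow> 'w \<Rightarrow> real ^ 'd" and u :: "nat \<Rightarrow> nat"
  assumes X: "\<And>k. k \<ge> 1 \<Longrightarrow> random_vector H (X k)" and ident: "identical_sequence E X"
    and c: "c > 0"
    and mix: "mixing_bound E \<alpha> X c"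
    and \<alpha>: "\<alpha> > 0" and \<delta>: "\<delta> > 0" and a: "a > 0"
    and u1: "\<And>i. u i \<ge> 1"
    and gap: "\<And>i. real (u i) + \<delta> * real (Suc i) \<le> real (u (Suc i))"
    and l: "l > 0" and g: "l-lipschitz_on UNIV g"
  shows "\<bar>E (\<lambda>\<omega>. g (a *\<^sub>R (\<Sum>i<j. X (u i) \<omega>))) - (step (X 1) a ^^ j) g 0\<bar>
    \<le> c * l * a * (\<Sum>i<j. real (Suc i) * exp (- \<alpha> * \<delta>) ^ i)"
  using g
proof (induction j arbitrary: g)
  case 0
  show ?case by (simp add: E_const)
next
  case (Suc j)
  note g = Suc.prems
  have X1: "random_vector H (X 1)" by (rule X) simp
  \<comment> \<open>The inner expectation of the mixing condition, with the earlier summands frozen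
    in s, is one application of \<open>step\<close> by identical distribution.\<close>
  have copy: "E (\<lambda>\<omega>'. g (s + a *\<^sub>R X (u j) \<omega>')) = step (X 1) a g s" for s
  proof -
    let ?\<psi> = "\<lambda>y. g (s + a *\<^sub>R y)"
    have "\<exists>L. L-lipschitz_on UNIV ?\<psi>"
      using lipschitz_affine[OF g] by blast
    then have "E (\<lambda>\<omega>. ?\<psi> (X (u j) \<omega>)) = E (\<lambda>\<omega>. ?\<psi> (X 1 \<omega>))"
      using ident[unfolded identical_sequence_def, rule_format, of "u j" 1 ?\<psi>] u1 by simp
    then show ?thesis by (simp add: step_def)
  qed
  have "\<bar>E (\<lambda>\<omega>. g (a *\<^sub>R (\<Sum>i<Suc j. X (u i) \<omega>)))
      - E (\<lambda>\<omega>. step (X 1) a g (a *\<^sub>R (\<Sum>i<j. X (u i) \<omega>)))\<bar>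
    \<le> c * l * a * (real (Suc j) * exp (- \<alpha> * \<delta>) ^ j)"
  proof (cases "j = 0")
    \<comment> \<open>No earlier block exists here, so mixing does not apply; the two expectations
      coincide.\<close>
    case True
    then show ?thesis
      using copy[of 0] c l a by (simp add: E_const)
  next
    case False
    have "u i < u (Suc i)" for i
      using gap[of i] \<delta> by (smt (verit) mult_pos_pos of_nat_0_less_iff of_nat_less_iff zero_less_Suc)
    then have mono: "strict_mono u" by (simp add: strict_mono_Suc_iff)
    \<comment> \<open>Mixing speaks of averages, so the average of the first j summands is
      multiplied by j. This produces the factor \<open>Suc j\<close> in the Lipschitz constant and
      hence in the error sum.\<close>
    let ?\<Lambda> = "u ` {..<j}" and ?\<phi> = "\<lambda>(x, y). g (a *\<^sub>R (real j *\<^sub>R x + y))"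
    let ?l = "l * (a * real (Suc j))"
    have inj: "inj_on u {..<j}"
      using mono by (simp add: strict_mono_on_imp_inj_on strict_mono_imp_inj_on)
    have avg1: "real j *\<^sub>R avg X ?\<Lambda> \<omega> = (\<Sum>i<j. X (u i) \<omega>)" for \<omega>
      using False by (simp add: avg_def card_image[OF inj] sum.reindex[OF inj])
    have avg2: "avg X {u j} \<omega> = X (u j) \<omega>" for \<omega>
      by (simp add: avg_def)
    have max: "Max ?\<Lambda> = u (j - 1)"
    proof (rule Max_eqI)
      show "u (j - 1) \<in> ?\<Lambda>" using False by simp
      show "y \<le> u (j - 1)" if "y \<in> ?\<Lambda>" for y
        using that strict_mono_mono[OF mono] by (auto simp: mono_def)
    qed simp
    have gap': "\<delta> * real j \<le> real (u j) - real (u (j - 1))"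
      using gap[of "j - 1"] False by simp
    have lip: "?l-lipschitz_on UNIV ?\<phi>"
    proof (rule lipschitz_onI)
      fix z w :: "(real ^ 'd) \<times> (real ^ 'd)"
      let ?f = "\<lambda>z. a *\<^sub>R (real j *\<^sub>R fst z + snd z)"
      have "dist (?f z) (?f w) = a * norm (real j *\<^sub>R fst (z - w) + snd (z - w))"
        using a by (simp add: dist_norm scaleR_diff_right[symmetric])
          (simp add: algebra_simps)
      also have "norm (real j *\<^sub>R fst (z - w) + snd (z - w))
          \<le> real j * norm (fst (z - w)) + norm (snd (z - w))"
        using norm_triangle_ineq[of "real j *\<^sub>R fst (z - w)"] by simp
      also have "\<dots> \<le> real j * norm (z - w) + norm (z - w)"
        using norm_fst_le[of "fst (z - w)" "snd (z - w)"] norm_snd_le[of "snd (z - w)" "fst (z - w)"]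
        unfolding prod.collapse by (intro add_mono mult_left_mono) simp_all
      finally have "dist (?f z) (?f w) \<le> a * real (Suc j) * dist z w"
        using a by (simp add: dist_norm algebra_simps)
      then have "l * dist (?f z) (?f w) \<le> l * (a * real (Suc j) * dist z w)"
        using l by (intro mult_left_mono) auto
      then show "dist (?\<phi> z) (?\<phi> w) \<le> ?l * dist z w"
        using lipschitz_onD[OF g, of "?f z" "?f w"] by (simp add: case_prod_beta mult.assoc)
    qed (use l a in simp)
    have "\<bar>E (\<lambda>\<omega>. ?\<phi> (avg X ?\<Lambda> \<omega>, avg X {u j} \<omega>))
        - E (\<lambda>\<omega>. E (\<lambda>\<omega>'. ?\<phi> (avg X ?\<Lambda> \<omega>, avg X {u j} \<omega>')))\<bar>
      \<le> c * ?l * exp (- \<alpha> * \<bar>real (Min {u j}) - real (Max ?\<Lambda>)\<bar>)"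
    proof (rule mix[unfolded mixing_bound_def, rule_format, OF _ conjI[OF _ lip]])
      have "Max ?\<Lambda> \<le> Min {u j}"
        using strict_mono_mono[OF mono] by (simp add: max mono_def)
      then show "finite ?\<Lambda> \<and> ?\<Lambda> \<noteq> {} \<and> ?\<Lambda> \<subseteq> {1..} \<and>
          finite {u j} \<and> {u j} \<noteq> {} \<and> {u j} \<subseteq> {1..} \<and> Max ?\<Lambda> \<le> Min {u j}"
        using False u1 by auto
      show "?l > 0" using l a by simp
    qed
    also have "E (\<lambda>\<omega>. E (\<lambda>\<omega>'. ?\<phi> (avg X ?\<Lambda> \<omega>, avg X {u j} \<omega>')))
        = E (\<lambda>\<omega>. step (X 1) a g (a *\<^sub>R (\<Sum>i<j. X (u i) \<omega>)))"
      by (simp only: prod.case scaleR_add_right avg1 avg2 copy)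
    also have "E (\<lambda>\<omega>. ?\<phi> (avg X ?\<Lambda> \<omega>, avg X {u j} \<omega>))
        = E (\<lambda>\<omega>. g (a *\<^sub>R (\<Sum>i<Suc j. X (u i) \<omega>)))"
      by (simp add: avg1 avg2)
    also have "exp (- \<alpha> * \<bar>real (Min {u j}) - real (Max ?\<Lambda>)\<bar>) \<le> exp (- \<alpha> * (\<delta> * real j))"
      using \<alpha> gap' by (simp add: max)
    also have "exp (- \<alpha> * (\<delta> * real j)) = exp (- \<alpha> * \<delta>) ^ j"
      by (simp add: exp_of_nat_mult[symmetric] mult_ac)
    finally show ?thesis
      using c l a by (simp add: mult_ac)
  qed
  \<comment> \<open>The induction hypothesis is used for \<open>step (X 1) a g\<close>, which has
    the same Lipschitz constant as g.\<close>
  moreover have "\<bar>E (\<lambda>\<omega>. step (X 1) a g (a *\<^sub>R (\<Sum>i<j. X (u i) \<omega>)))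
      - (step (X 1) a ^^ Suc j) g 0\<bar> \<le> c * l * a * (\<Sum>i<j. real (Suc i) * exp (- \<alpha> * \<delta>) ^ i)"
    using Suc.IH[OF step_lipschitz[OF X1 g]] by (simp add: funpow_swap1)
  ultimately show ?case
    by (simp only: sum.lessThan_Suc distrib_left)
qed

end

section \<open>Growth of the polynomial times\<close>

lemma lead_coeff_pos_imp_ge_linear:
  fixes p :: "real poly"
  assumes deg: "degree p \<ge> 1" and lc: "lead_coeff p > 0"
  obtains \<delta> n where "\<delta> > 0" "\<And>x. x \<ge> n \<Longrightarrow> poly p x \<ge> \<delta> * x + c"
proof -
  \<comment> \<open>With half the leading coefficient as slope, \<open>q\<close> keeps a positive
    leading coefficient even if \<open>p\<close> has degree 1.\<close>
  define \<delta> where "\<delta> = lead_coeff p / 2"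
  define q where "q = p - [:c, \<delta>:]"
  have pos: "coeff q (degree p) > 0"
    using deg lc by (cases "degree p") (auto simp: q_def \<delta>_def coeff_pCons split: nat.split)
  have "degree q \<le> degree p"
    unfolding q_def using deg by (intro degree_diff_le) auto
  then have "degree q = degree p"
    using pos le_degree[of q "degree p"] by simp
  then obtain n where "\<forall>x\<ge>n. lead_coeff q \<le> poly q x"
    using poly_pinfty_gt_lc[of q] pos by auto
  then have "poly p x \<ge> \<delta> * x + c" if "x \<ge> n" for x
    using that pos \<open>degree q = degree p\<close> by (fastforce simp: q_def algebra_simps)
  then show thesis
    using that[of \<delta> n] lc by (simp add: \<delta>_def)
qed

text \<open>By the mean value theorem P (k + 1) - P k is a value of the derivative beyond k, and the
  derivative has degree at least 1 and positive leading coefficient.\<close>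

lemma poly_time_gap:
  assumes deg: "degree P \<ge> 2" and lc: "lead_coeff P > 0"
  obtains \<delta> N where "\<delta> > 0"
    "\<And>k. k \<ge> N \<Longrightarrow> real (poly_time P k) + \<delta> * real k \<le> real (poly_time P (Suc k))"
proof -
  have deg': "degree (pderiv P) = degree P - 1" by (rule degree_pderiv)
  have "lead_coeff (pderiv P) = real (degree P) * lead_coeff P"
    using deg by (simp add: deg' coeff_pderiv)
  then have lc': "lead_coeff (pderiv P) > 0" using lc deg by simp
  have "degree (pderiv P) \<ge> 1" using deg deg' by simp
  \<comment> \<open>The additive 1 pays for rounding down P (k + 1).\<close>
  from this lc' obtain \<delta> n where \<delta>: "\<delta> > 0" and n: "\<And>x. x \<ge> n \<Longrightarrow> poly (pderiv P) x \<ge> \<delta> * x + 1"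
    by (rule lead_coeff_pos_imp_ge_linear[where c = 1]) blast
  \<comment> \<open>This ensures P k \<ge> 1 eventually, so that the maximum with 1 does not lift
    the time above P k.\<close>
  obtain \<delta>' n' where \<delta>': "\<delta>' > 0" and n': "\<And>x. x \<ge> n' \<Longrightarrow> poly P x \<ge> \<delta>' * x + 1"
    by (rule lead_coeff_pos_imp_ge_linear[OF _ lc]) (use deg in auto)
  define N where "N = nat \<lceil>max n n'\<rceil>"
  have "real (poly_time P k) + \<delta> * real k \<le> real (poly_time P (Suc k))" if "k \<ge> N" for k
  proof -
    have k: "real k \<ge> n" "real k \<ge> n'"
      using that by (auto simp: N_def nat_le_iff ceiling_le_iff)
    have "0 \<le> \<delta>' * real k" using \<delta>' by simp
    then have "poly P (real k) \<ge> 1" using n'[OF k(2)] by linarith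
    then have t: "real (poly_time P k) \<le> poly P (real k)"
      by (simp add: poly_time_def max_def)
    have "poly P (real (Suc k)) - 1 \<le> real_of_int \<lfloor>poly P (real (Suc k))\<rfloor>"
      by linarith
    also have "\<dots> \<le> real (poly_time P (Suc k))"
      by (simp add: poly_time_def)
    finally have t': "poly P (real (Suc k)) - 1 \<le> real (poly_time P (Suc k))" .
    obtain x where x: "real k < x" "poly P (real (Suc k)) - poly P (real k) = poly (pderiv P) x"
      using poly_MVT[of "real k" "real (Suc k)" P] by auto
    have "\<delta> * real k \<le> \<delta> * x" using x \<delta> by simp
    then show ?thesis
      using n[of x] x k t t' by linarith
  qed
  then show thesis using that \<delta> by blast
qed

section \<open>Choice of constants and assembly of the rate\<close>

theorem theorem1p7:
  fixes H :: "('w \<Rightarrow> real) set"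
    and Ehat :: "('w \<Rightarrow> real) \<Rightarrow> real"
    and X :: "nat \<Rightarrow> 'w \<Rightarrow> real ^ 'd"
    and \<alpha> :: real
    and P :: "real poly"
  assumes "rv_space H"
    and "sublinear_expectation H Ehat"
    and "\<And>k. k \<ge> 1 \<Longrightarrow> random_vector H (X k)"
    and "identical_sequence Ehat X"
    and "\<alpha> > 0"
    and "alpha_mixing Ehat \<alpha> X"
    and "(\<lambda>\<omega>. (abs_vec (X 1 \<omega>))\<^sup>2) \<in> H"
    and "degree P \<ge> 2"
    and "lead_coeff P > 0"
  shows "\<exists>C>0. \<forall>(\<phi> :: real ^ 'd \<Rightarrow> real) l. l > 0 \<and> l-lipschitz_on UNIV \<phi> \<longrightarrow>
           (\<exists>x \<in> mean_set H Ehat (X 1).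
              (\<forall>y \<in> mean_set H Ehat (X 1). \<phi> y \<le> \<phi> x) \<and>
              (\<forall>n\<ge>1.
                 \<bar>Ehat (\<lambda>\<omega>. \<phi> ((1 / real n) *\<^sub>R (\<Sum>k=1..n. X (poly_time P k) \<omega>))) - \<phi> x\<bar>
                   \<le> C * l * real n powr (- 1 / 2)))"
proof -
  interpret sublinear_space H Ehat
    using assms(1,2) by (rule sublinear_space.intro)
  let ?Y = "X 1"
  let ?K = "mean_set H Ehat ?Y"
  have Y: "random_vector H ?Y" by (rule assms(3)) simp
  have K: "?K = support_set ?Y" by (rule mean_set_eq_support_set[OF Y])
  define Q where "Q = Ehat (\<lambda>\<omega>. (abs_vec (?Y \<omega>))\<^sup>2)"
  have Q: "Q \<ge> 0"
    unfolding Q_def using E_mono[OF zero_in assms(7)] by (simp add: E_const)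
  define R where "R = Ehat (\<lambda>\<omega>. norm (?Y \<omega>))"
  have R: "norm x \<le> R" if "x \<in> support_set ?Y" for x
    unfolding R_def by (rule support_set_norm_le[OF Y that])
  obtain x0 where x0: "x0 \<in> support_set ?Y"
    using support_set_attains[OF Y, of 0] by blast
  have R0: "R \<ge> 0" using R[OF x0] norm_ge_zero[of x0] by linarith
  obtain c where c: "c > 0" and mix: "mixing_bound Ehat \<alpha> X c"
    using assms(6) by (auto simp: alpha_mixing_iff)
  obtain \<delta> N where \<delta>: "\<delta> > 0"
    and gap: "\<And>k. k \<ge> N \<Longrightarrow> real (poly_time P k) + \<delta> * real k \<le> real (poly_time P (Suc k))"
    using poly_time_gap[OF assms(8,9)] by blast
  have t1: "poly_time P k \<ge> 1" for k
    by (simp add: poly_time_def)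
  \<comment> \<open>The times from index N + 1 on, where the gap estimate is valid; the first N are
    treated separately.\<close>
  define u where "u i = poly_time P (Suc (N + i))" for i
  have u1: "u i \<ge> 1" for i by (simp only: u_def t1)
  have u_gap: "real (u i) + \<delta> * real (Suc i) \<le> real (u (Suc i))" for i
  proof -
    have "\<delta> * real (Suc i) \<le> \<delta> * real (Suc (N + i))"
      using \<delta> by (intro mult_left_mono) auto
    then show ?thesis
      using gap[of "Suc (N + i)"] by (simp add: u_def)
  qed
  define r where "r = exp (- \<alpha> * \<delta>)"
  have r: "0 < r" "r < 1"
    using \<delta> assms(5) by (auto simp: r_def)
  \<comment> \<open>The sum of the differentiated geometric series, which bounds the mixing error
    uniformly in j.\<close>
  define D where "D = 1 / (1 - r)\<^sup>2"
  have D: "(\<Sum>i<j. real (Suc i) * r ^ i) \<le> D" for j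
    using geometric_deriv_sums[of r] r by (intro sum_le_suminf[THEN order_trans])
      (auto simp: D_def sums_iff intro: order_refl)
  have D0: "D > 0" using r by (simp add: D_def)
  \<comment> \<open>N R occurs twice: once for discarding the first summands and once for the
    displaced reference point. The term c D comes from mixing, 1 from the offset \<epsilon>, and Q +
    R^2 from the quadratic remainders.\<close>
  define C where "C = 2 * real N * R + c * D + 1 + Q + R\<^sup>2"
  have C: "C > 0" using R0 c D0 Q by (simp add: C_def add_nonneg_pos add_pos_nonneg)
  show ?thesis
  proof (intro exI[of _ C] conjI C allI impI)
    fix \<phi> :: "real ^ 'd \<Rightarrow> real" and l assume "l > 0 \<and> l-lipschitz_on UNIV \<phi>"
    then have l: "l > 0" and \<phi>: "l-lipschitz_on UNIV \<phi>" by auto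
    have "continuous_on ?K \<phi>"
      using lipschitz_on_continuous_on[OF \<phi>] by (rule continuous_on_subset) simp
    then obtain x where x: "x \<in> ?K" and max: "\<forall>y\<in>?K. \<phi> y \<le> \<phi> x"
      using continuous_attains_sup[of ?K \<phi>] compact_support_set[OF Y] x0 K by auto
    have "\<bar>Ehat (\<lambda>\<omega>. \<phi> ((1 / real n) *\<^sub>R (\<Sum>k=1..n. X (poly_time P k) \<omega>))) - \<phi> x\<bar>
        \<le> C * l * real n powr (- 1 / 2)" if n: "n \<ge> 1" for n
    proof -
      define a where "a = 1 / real n"
      \<comment> \<open>Balances the offset \<epsilon> of the smoothed norm against the accumulated
        remainders, which are of order a / \<epsilon> because j a \<le> 1.\<close>
      define \<epsilon> where "\<epsilon> = 1 / sqrt (real n)"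
      have a: "a > 0" and \<epsilon>: "\<epsilon> > 0" and \<epsilon>2: "\<epsilon> * \<epsilon> = a"
        using n by (auto simp: a_def \<epsilon>_def)
      have "a \<le> \<epsilon>"
      proof -
        have "\<epsilon> \<le> 1" using n by (simp add: \<epsilon>_def)
        then show ?thesis using mult_left_mono[of \<epsilon> 1 \<epsilon>] \<epsilon> \<epsilon>2 by simp
      qed
      define b where "b = a\<^sup>2 * (Q + R\<^sup>2) / \<epsilon>"
      \<comment> \<open>Truncated subtraction: if n \<le> N, then j = 0 and all n summands are
        discarded.\<close>
      define j where "j = n - N"
      define m where "m = min n N"
      have jm: "n = m + j" by (simp add: j_def m_def)
      have ja: "1 - real j * a = real m * a" and ja1: "real j * a \<le> 1"
        using n by (auto simp: jm a_def field_simps)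
      have ma: "real m * a * R \<le> real N * R * \<epsilon>"
      proof -
        have "real m * a \<le> real N * \<epsilon>"
          using \<open>a \<le> \<epsilon>\<close> a by (intro mult_mono) (auto simp: m_def)
        from mult_right_mono[OF this R0] show ?thesis by (simp add: mult_ac)
      qed
      have jb: "real j * b \<le> (Q + R\<^sup>2) * \<epsilon>"
      proof -
        have "b = a * ((Q + R\<^sup>2) * \<epsilon>)"
          using \<epsilon> by (simp add: b_def \<epsilon>2[symmetric] power2_eq_square)
        then have "real j * b = (real j * a) * ((Q + R\<^sup>2) * \<epsilon>)" by simp
        also have "\<dots> \<le> 1 * ((Q + R\<^sup>2) * \<epsilon>)"
          using ja1 Q \<epsilon> by (intro mult_right_mono) auto
        finally show ?thesis by simp
      qed
      \<comment> \<open>Only j of the n steps are made, so the reference point is (m a) z; its norm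
        is at most N R \<epsilon>.\<close>
      have near: "norm (\<epsilon>, 0 - (1 - real j * a) *\<^sub>R z) + real j * b
          \<le> (real N * R + 1 + Q + R\<^sup>2) * \<epsilon>" if "z \<in> support_set ?Y" for z
      proof -
        have "norm (\<epsilon>, 0 - (real m * a) *\<^sub>R z) \<le> norm \<epsilon> + norm ((real m * a) *\<^sub>R z)"
          using norm_Pair_le[of \<epsilon> "0 - (real m * a) *\<^sub>R z"] by simp
        also have "norm ((real m * a) *\<^sub>R z) \<le> real m * a * R"
          using a R[OF that] by (simp add: mult_left_mono)
        finally show ?thesis
          unfolding ja using ma jb \<epsilon> by (simp add: algebra_simps)
      qed

      define S where "S \<omega> = (\<Sum>k=1..n. X (poly_time P k) \<omega>)" for \<omega>
      define A where "A \<omega> = (\<Sum>k=1..m. X (poly_time P k) \<omega>)" for \<omega>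
      define B where "B \<omega> = (\<Sum>i<j. X (u i) \<omega>)" for \<omega>
      have SAB: "S \<omega> = A \<omega> + B \<omega>" for \<omega>
      proof (cases "n \<le> N")
        case True
        then show ?thesis by (simp add: S_def A_def B_def j_def m_def)
      next
        case False
        then have "m = N" by (simp add: m_def)
        have "S \<omega> = A \<omega> + (\<Sum>k=m+1..m+j. X (poly_time P k) \<omega>)"
          unfolding S_def A_def jm by (rule sum.ub_add_nat) simp
        also have "(\<Sum>k=m+1..m+j. X (poly_time P k) \<omega>) = B \<omega>"
          unfolding B_def u_def
          by (rule sum.reindex_bij_witness[of _ "\<lambda>i. Suc (N + i)" "\<lambda>k. k - Suc N"])
            (auto simp: \<open>m = N\<close>)
        finally show ?thesis .
      qed
      have Xt: "random_vector H (X (poly_time P k))" for k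
        by (rule assms(3)[OF t1])
      have "random_vector H S" "random_vector H B"
        unfolding S_def B_def u_def by (intro random_vector_sum Xt)+
      note SB = affine_in[OF this(1) \<phi>, of 0 a] affine_in[OF this(2) \<phi>, of 0 a]
      \<comment> \<open>Each discarded summand has expected norm R, by identical
        distribution.\<close>
      have normA: "(\<lambda>\<omega>. \<Sum>k=1..m. norm (X (poly_time P k) \<omega>)) \<in> H \<and>
          Ehat (\<lambda>\<omega>. \<Sum>k=1..m. norm (X (poly_time P k) \<omega>)) \<le> real m * R"
      proof (induction m)
        case (Suc m)
        have "1-lipschitz_on UNIV (norm :: real ^ 'd \<Rightarrow> real)"
          by (auto intro!: lipschitz_onI simp: dist_norm norm_triangle_ineq3)
        then have "Ehat (\<lambda>\<omega>. norm (X (poly_time P (Suc m)) \<omega>)) = R"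
          unfolding R_def
          using assms(4)[unfolded identical_sequence_def, rule_format, of "poly_time P (Suc m)" 1 norm] t1
          by auto
        then show ?case
          using Suc E_add[OF conjunct1[OF Suc] norm_in[OF Xt[of "Suc m"]]]
            add_in[OF conjunct1[OF Suc] norm_in[OF Xt[of "Suc m"]]]
          by (simp add: algebra_simps)
      qed (simp add: zero_in E_const)
      have "\<bar>Ehat (\<lambda>\<omega>. \<phi> (0 + a *\<^sub>R S \<omega>)) - Ehat (\<lambda>\<omega>. \<phi> (0 + a *\<^sub>R B \<omega>))\<bar>
          \<le> Ehat (\<lambda>\<omega>. (l * a) * (\<Sum>k=1..m. norm (X (poly_time P k) \<omega>)))"
      proof (rule E_diff[OF SB scale_in[OF conjunct1[OF normA]]])
        fix \<omega>
        have "\<bar>\<phi> (0 + a *\<^sub>R S \<omega>) - \<phi> (0 + a *\<^sub>R B \<omega>)\<bar> \<le> l * (a * norm (A \<omega>))"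
          using lipschitz_onD[OF \<phi>, of "0 + a *\<^sub>R S \<omega>" "0 + a *\<^sub>R B \<omega>"] a
          by (simp add: dist_norm scaleR_diff_right[symmetric] SAB)
        also have "\<dots> \<le> l * (a * (\<Sum>k=1..m. norm (X (poly_time P k) \<omega>)))"
          unfolding A_def using l a by (intro mult_left_mono norm_sum) auto
        finally show "\<bar>\<phi> (0 + a *\<^sub>R S \<omega>) - \<phi> (0 + a *\<^sub>R B \<omega>)\<bar>
            \<le> (l * a) * (\<Sum>k=1..m. norm (X (poly_time P k) \<omega>))" by (simp add: mult_ac)
      qed
      also have "\<dots> \<le> (l * a) * (real m * R)"
        using E_scale[OF conjunct1[OF normA], of "l * a"] normA l a by (simp add: mult_left_mono)
      also have "\<dots> = l * (real m * a * R)" by simp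
      also have "\<dots> \<le> l * (real N * R * \<epsilon>)"
        using ma l by (intro mult_left_mono) auto
      finally have 1: "\<bar>Ehat (\<lambda>\<omega>. \<phi> (a *\<^sub>R S \<omega>)) - Ehat (\<lambda>\<omega>. \<phi> (a *\<^sub>R B \<omega>))\<bar>
          \<le> l * (real N * R * \<epsilon>)" by simp
      have "\<bar>Ehat (\<lambda>\<omega>. \<phi> (a *\<^sub>R B \<omega>)) - (step ?Y a ^^ j) \<phi> 0\<bar>
          \<le> c * l * a * (\<Sum>i<j. real (Suc i) * r ^ i)"
        unfolding B_def r_def
        by (rule mixing_iterate[OF assms(3,4) c mix assms(5) \<delta> a u1 u_gap l \<phi>])
      also have "\<dots> \<le> c * l * \<epsilon> * D"
        using D \<open>a \<le> \<epsilon>\<close> c l a \<epsilon> r by (intro mult_mono sum_nonneg) auto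
      finally have 2: "\<bar>Ehat (\<lambda>\<omega>. \<phi> (a *\<^sub>R B \<omega>)) - (step ?Y a ^^ j) \<phi> 0\<bar> \<le> l * (c * D * \<epsilon>)"
        by (simp add: mult_ac)

      \<comment> \<open>Scaling a point of the support set by 1 - j a \<ge> 0 gives an admissible
        \<pi>; the bound on \<phi> over the whole set brings in the maximum.\<close>
      have "(step ?Y a ^^ j) \<phi> 0
          \<le> \<phi> x + l * (norm (\<epsilon>, 0 - (1 - real j * a) *\<^sub>R x0) + real j * b)"
        unfolding b_def Q_def
      proof (rule step_iterate_upper[OF Y assms(7) \<epsilon> less_imp_le[OF a] \<phi> _ R])
        show "\<phi> y \<le> \<phi> x" if "y \<in> support_set ?Y" for y
          using max that K by auto
        show "p \<bullet> (1 - real j * a) *\<^sub>R x0 \<le> (1 - real j * a) * Ehat (\<lambda>\<omega>. p \<bullet> ?Y \<omega>)" for p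
          using x0 ja1 by (simp add: support_set_def mult_left_mono)
      qed
      also have "\<dots> \<le> \<phi> x + l * ((real N * R + 1 + Q + R\<^sup>2) * \<epsilon>)"
        using near[OF x0] l by (intro add_left_mono mult_left_mono) auto
      finally have 3: "(step ?Y a ^^ j) \<phi> 0 \<le> \<phi> x + l * ((real N * R + 1 + Q + R\<^sup>2) * \<epsilon>)" .

      \<comment> \<open>For the lower bound the reference point is a multiple of the maximiser
        itself.\<close>
      have "\<phi> x - l * ((real N * R + 1 + Q + R\<^sup>2) * \<epsilon>)
          \<le> \<phi> x - l * (norm (\<epsilon>, 0 - (1 - real j * a) *\<^sub>R x) + real j * b)"
        using near[of x] x K l by (intro diff_left_mono mult_left_mono) auto
      also have "\<dots> \<le> (step ?Y a ^^ j) \<phi> 0"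
        unfolding b_def Q_def using R x K
        by (intro step_iterate_lower[OF Y assms(7) \<epsilon> less_imp_le[OF a] \<phi>]) auto
      finally have "\<phi> x - l * ((real N * R + 1 + Q + R\<^sup>2) * \<epsilon>) \<le> (step ?Y a ^^ j) \<phi> 0" .
      then have "\<bar>Ehat (\<lambda>\<omega>. \<phi> (a *\<^sub>R S \<omega>)) - \<phi> x\<bar>
          \<le> l * (real N * R * \<epsilon>) + l * (c * D * \<epsilon>) + l * ((real N * R + 1 + Q + R\<^sup>2) * \<epsilon>)"
        using 1 2 3 by linarith
      also have "\<dots> = C * l * \<epsilon>"
        by (simp add: C_def algebra_simps)
      also have "\<epsilon> = real n powr (- 1 / 2)"
        using n by (simp add: \<epsilon>_def powr_minus_divide powr_half_sqrt)
      finally show ?thesis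
        by (simp add: a_def S_def)
    qed
    then show "\<exists>x\<in>?K. (\<forall>y\<in>?K. \<phi> y \<le> \<phi> x) \<and>
        (\<forall>n\<ge>1. \<bar>Ehat (\<lambda>\<omega>. \<phi> ((1 / real n) *\<^sub>R (\<Sum>k=1..n. X (poly_time P k) \<omega>))) - \<phi> x\<bar>
          \<le> C * l * real n powr (- 1 / 2))"
      using x max by blast
  qed
qed

end
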